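(* Let $\lambda>0$, $G_0\in L^2(-1,1)$ and $\wp\in\mathbb{R}$. Then there exists a (weak) solution $G\in C\big((0,\infty);L^2(-1,1)\big)\cap L^2_{\rm loc}\big((0,\infty);H^1_\rho(-1,1)\big)$, with $\partial_tG\in L^2_{\rm loc}\big((0,\infty);H^{-1}(-1,1)\big)$, of $$\begin{cases}\dfrac{\partial G}{\partial t} = \dfrac{\lambda}{2}(1-x^2)\dfrac{\partial^2G}{\partial x^2}, & t>0,\ x\in(-1,1),\\ G(x,0)=G_0(x), & x\in(-1,1),\\ G(1,t)=1,\quad G(-1,t)=\wp, & t>0.\end{cases}$$ If moreover $G_0\in H^1(-1,1)$, then $\partial_xG\in L^2_{\rm loc}\big((0,\infty);H^1_\rho(-1,1)\big)$, $G\in C\big((0,\infty);H^1(-1,1)\big)$ and $\partial_tG\in L^2_{\rm loc}\big((0,\infty);L^2(-1,1)\big)$.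
   Context: The weighted Sobolev space is $H^1_\rho(-1,1) := \{v\in L^2(-1,1): \sqrt{1-x^2}\,\partial_x v\in L^2(-1,1)\}$. The boundary values $G(\pm1,t)$ are understood as traces. *)

theory Defs
  imports "HOL-Analysis.Analysis"
begin

text \<open>Spatial domain (-1,1). Functions of space are of type real => real (values
outside (-1,1) irrelevant); space-time functions are G :: real => real => real, read G x t.\<close>

abbreviation Ioo11 :: "real set" where "Ioo11 \<equiv> {-1<..<1}"

definition L2 :: "(real \<Rightarrow> real) \<Rightarrow> bool" where
  "L2 f \<longleftrightarrow> set_borel_measurable lborel Ioo11 f \<and> set_integrable lborel Ioo11 (\<lambda>x. (f x)^2)"

definition L2_dist :: "(real \<Rightarrow> real) \<Rightarrow> (real \<Rightarrow> real) \<Rightarrow> real" where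
  "L2_dist f g = sqrt (LINT x:Ioo11|lborel. (f x - g x)^2)"

definition smooth_fun :: "(real \<Rightarrow> real) \<Rightarrow> bool" where
  "smooth_fun f \<longleftrightarrow> (\<forall>n x. ((deriv ^^ n) f) differentiable (at x))"

definition test_fun_x :: "(real \<Rightarrow> real) \<Rightarrow> bool" where
  "test_fun_x v \<longleftrightarrow> smooth_fun v \<and> (\<exists>a b. -1 < a \<and> b < 1 \<and> (\<forall>x. x \<notin> {a..b} \<longrightarrow> v x = 0))"

definition test_fun_t :: "(real \<Rightarrow> real) \<Rightarrow> bool" where
  "test_fun_t w \<longleftrightarrow> smooth_fun w \<and> (\<exists>a b. 0 < a \<and> (\<forall>t. t \<notin> {a..b} \<longrightarrow> w t = 0))"

definition loc_int :: "(real \<Rightarrow> real) \<Rightarrow> bool" where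
  "loc_int f \<longleftrightarrow> (\<forall>a b. -1 < a \<longrightarrow> b < 1 \<longrightarrow> set_integrable lborel {a..b} f)"

definition weak_deriv :: "(real \<Rightarrow> real) \<Rightarrow> (real \<Rightarrow> real) \<Rightarrow> bool" where
  "weak_deriv f g \<longleftrightarrow> loc_int f \<and> loc_int g \<and>
     (\<forall>\<phi>. test_fun_x \<phi> \<longrightarrow>
        (LINT x:Ioo11|lborel. f x * deriv \<phi> x) = - (LINT x:Ioo11|lborel. g x * \<phi> x))"

definition H1rho :: "(real \<Rightarrow> real) \<Rightarrow> bool" where
  "H1rho f \<longleftrightarrow> L2 f \<and> (\<exists>g. weak_deriv f g \<and> L2 (\<lambda>x. sqrt (1 - x^2) * g x))"

definition H1 :: "(real \<Rightarrow> real) \<Rightarrow> bool" where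
  "H1 f \<longleftrightarrow> L2 f \<and> (\<exists>g. weak_deriv f g \<and> L2 g)"

definition wderiv :: "(real \<Rightarrow> real) \<Rightarrow> (real \<Rightarrow> real)" where
  "wderiv f = (SOME g. weak_deriv f g)"

definition H1_dist :: "(real \<Rightarrow> real) \<Rightarrow> (real \<Rightarrow> real) \<Rightarrow> real" where
  "H1_dist f g = sqrt ((L2_dist f g)^2 + (L2_dist (wderiv f) (wderiv g))^2)"

definition trace_at_1 :: "(real \<Rightarrow> real) \<Rightarrow> real \<Rightarrow> bool" where
  "trace_at_1 f c \<longleftrightarrow> (\<exists>h. continuous_on Ioo11 h \<and> (AE x in lborel. x \<in> Ioo11 \<longrightarrow> f x = h x)
                        \<and> (h \<longlongrightarrow> c) (at_left 1))"

definition trace_at_m1 :: "(real \<Rightarrow> real) \<Rightarrow> real \<Rightarrow> bool" where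
  "trace_at_m1 f c \<longleftrightarrow> (\<exists>h. continuous_on Ioo11 h \<and> (AE x in lborel. x \<in> Ioo11 \<longrightarrow> f x = h x)
                        \<and> (h \<longlongrightarrow> c) (at_right (-1)))"

definition L2loc_L2 :: "(real \<Rightarrow> real \<Rightarrow> real) \<Rightarrow> bool" where
  "L2loc_L2 F \<longleftrightarrow>
     set_borel_measurable (lborel \<Otimes>\<^sub>M lborel) (Ioo11 \<times> {0<..}) (\<lambda>(x,t). F x t) \<and>
     (\<forall>a b. 0 < a \<longrightarrow> set_integrable (lborel \<Otimes>\<^sub>M lborel) (Ioo11 \<times> {a..b}) (\<lambda>(x,t). (F x t)^2))"

definition C_L2 :: "(real \<Rightarrow> real \<Rightarrow> real) \<Rightarrow> bool" where
  "C_L2 G \<longleftrightarrow> (\<forall>t>0. L2 (\<lambda>x. G x t)) \<and>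
     (\<forall>t>0. ((\<lambda>s. L2_dist (\<lambda>x. G x s) (\<lambda>x. G x t)) \<longlongrightarrow> 0) (at t))"

definition C_H1 :: "(real \<Rightarrow> real \<Rightarrow> real) \<Rightarrow> bool" where
  "C_H1 G \<longleftrightarrow> (\<forall>t>0. H1 (\<lambda>x. G x t)) \<and>
     (\<forall>t>0. ((\<lambda>s. H1_dist (\<lambda>x. G x s) (\<lambda>x. G x t)) \<longlongrightarrow> 0) (at t))"

definition L2loc_H1rho :: "(real \<Rightarrow> real \<Rightarrow> real) \<Rightarrow> (real \<Rightarrow> real \<Rightarrow> real) \<Rightarrow> bool" where
  "L2loc_H1rho G Gx \<longleftrightarrow> L2loc_L2 G \<and> L2loc_L2 (\<lambda>x t. sqrt (1 - x^2) * Gx x t) \<and>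
     (AE t in lborel. t > 0 \<longrightarrow> weak_deriv (\<lambda>x. G x t) (\<lambda>x. Gx x t))"

definition pair :: "(real \<Rightarrow> real \<Rightarrow> real) \<Rightarrow> (real \<Rightarrow> real) \<Rightarrow> real \<Rightarrow> real" where
  "pair G v t = (LINT x:Ioo11|lborel. G x t * v x)"

text \<open>partial_t G in L^2_loc((0,infinity); H^{-1}(-1,1)): partial_t G = g0 + partial_x g1
  in the sense of distributions, with g0, g1 in L^2_loc((0,infinity); L^2(-1,1)).\<close>
definition dt_L2loc_Hm1 :: "(real \<Rightarrow> real \<Rightarrow> real) \<Rightarrow> bool" where
  "dt_L2loc_Hm1 G \<longleftrightarrow> (\<exists>g0 g1. L2loc_L2 g0 \<and> L2loc_L2 g1 \<and>
     (\<forall>v w. test_fun_x v \<longrightarrow> test_fun_t w \<longrightarrow>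
        (LINT t|lborel. deriv w t * pair G v t) =
          - (LINT t|lborel. w t * (pair g0 v t - pair g1 (deriv v) t))))"

definition dt_L2loc_L2 :: "(real \<Rightarrow> real \<Rightarrow> real) \<Rightarrow> bool" where
  "dt_L2loc_L2 G \<longleftrightarrow> (\<exists>Gt. L2loc_L2 Gt \<and>
     (\<forall>v w. test_fun_x v \<longrightarrow> test_fun_t w \<longrightarrow>
        (LINT t|lborel. deriv w t * pair G v t) = - (LINT t|lborel. w t * pair Gt v t)))"

text \<open>Weak form of  G_t = (lam/2)(1-x^2) G_xx :  for all test v, chi,
  int chi'(t) (G(t),v) dt = (lam/2) int chi(t) int G_x ((1-x^2) v)' dx dt.\<close>
definition weak_pde :: "real \<Rightarrow> (real \<Rightarrow> real \<Rightarrow> real) \<Rightarrow> (real \<Rightarrow> real \<Rightarrow> real) \<Rightarrow> bool" where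
  "weak_pde lam G Gx \<longleftrightarrow>
     (\<forall>v w. test_fun_x v \<longrightarrow> test_fun_t w \<longrightarrow>
        (LINT t|lborel. deriv w t * pair G v t) =
          lam / 2 * (LINT t|lborel. w t *
             (LINT x:Ioo11|lborel. Gx x t * ((1 - x^2) * deriv v x - 2 * x * v x))))"

definition weak_solution ::
  "real \<Rightarrow> (real \<Rightarrow> real) \<Rightarrow> real \<Rightarrow> (real \<Rightarrow> real \<Rightarrow> real) \<Rightarrow> (real \<Rightarrow> real \<Rightarrow> real) \<Rightarrow> bool" where
  "weak_solution lam G0 p G Gx \<longleftrightarrow>
     C_L2 G \<and> L2loc_H1rho G Gx \<and> dt_L2loc_Hm1 G \<and> weak_pde lam G Gx \<and>
     ((\<lambda>t. L2_dist (\<lambda>x. G x t) G0) \<longlongrightarrow> 0) (at_right 0) \<and>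
     (AE t in lborel. t > 0 \<longrightarrow> trace_at_1 (\<lambda>x. G x t) 1 \<and> trace_at_m1 (\<lambda>x. G x t) p)"

end

theory Submission
  imports Defs "HOL-Computational_Algebra.Polynomial"
begin

text \<open>
  The polynomials \<open>\<psi>\<^sub>n\<close> (derivatives of Legendre polynomials, normalised by \<open>\<psi>\<^sub>n(1) = 1\<close>) make
  \<open>\<phi>\<^sub>n = (1 - x\<^sup>2) \<psi>\<^sub>n\<close> eigenfunctions, \<open>(1 - x\<^sup>2) \<phi>\<^sub>n'' = - (n + 1) (n + 2) \<phi>\<^sub>n\<close>, and \<open>\<phi>\<^sub>m\<close> is orthogonal to
  \<open>\<psi>\<^sub>n\<close> for \<open>m \<noteq> n\<close>.  After subtracting the affine function with the prescribed boundary values,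
  the solution is the eigenfunction series with coefficients \<open>\<integral>u\<^sub>0 \<psi>\<^sub>n / \<integral>\<phi>\<^sub>n \<psi>\<^sub>n\<close>.  These grow at most
  exponentially in \<open>n\<close> while the time factors decay like \<open>exp (- c n\<^sup>2 t)\<close>, so the series is smooth up to the
  boundary for \<open>t > 0\<close> and every interior regularity claim holds, whatever \<open>u\<^sub>0 \<in> L\<^sup>2\<close> is.

  The initial datum is only in the unweighted \<open>L\<^sup>2\<close>, where the \<open>\<phi>\<^sub>n\<close> are not orthogonal.  Its
  attainment follows instead from the energy identity, which makes the evolution of finite sums an
  \<open>L\<^sup>2\<close>-contraction, and from the density of \<open>(1 - x\<^sup>2)\<close> times the polynomials.  Continuity in \<open>H\<^sup>1\<close> also
  needs uniqueness of weak derivatives, because the \<open>H\<^sup>1\<close> distance picks one by choice.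
\<close>

section \<open>Eigenpolynomials\<close>

text \<open>Expanding \<open>((1 - x\<^sup>2) y)'' = - (n + 1) (n + 2) y\<close> in powers of \<open>1 - x\<close> gives a two-term recursion for the
  coefficients, whose solution is a product of binomial coefficients.\<close>

definition jacobi_coeff :: "nat \<Rightarrow> nat \<Rightarrow> real" where
  "jacobi_coeff n k = (-1/2)^k * real (n choose k) * real ((n + k + 2) choose k) / real (k + 1)"

text \<open>Composition with \<open>[:1, -1:]\<close> substitutes \<open>1 - x\<close>. The result
  is the hypergeometric polynomial 2F1(-n, n + 3; 2; (1 - x)/2), a multiple of the Jacobi polynomial
  with both parameters 1.\<close>

definition psi :: "nat \<Rightarrow> real poly" where
  "psi n = pcompose (\<Sum>k\<le>n. monom (jacobi_coeff n k) k) [:1, -1:]"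

definition phi :: "nat \<Rightarrow> real poly" where
  "phi n = [:1, 0, -1:] * psi n"

definition eigval :: "nat \<Rightarrow> real" where
  "eigval n = (real n + 1) * (real n + 2)"

lemma eigval_pos: "eigval n > 0"
  by (simp add: eigval_def add_pos_nonneg)

lemma eigval_inj: "eigval m = eigval n \<Longrightarrow> m = n"
proof (rule ccontr)
  assume eq: "eigval m = eigval n" and "m \<noteq> n"
  have "eigval m - eigval n = (real m - real n) * (real m + real n + 3)"
    by (simp add: eigval_def algebra_simps)
  with eq \<open>m \<noteq> n\<close> show False
    by (simp add: add_nonneg_eq_0_iff)
qed

lemma jacobi_coeff_zero: "k > n \<Longrightarrow> jacobi_coeff n k = 0"
  by (simp add: jacobi_coeff_def)

lemma jacobi_coeff_self_nonzero: "jacobi_coeff n n \<noteq> 0"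
proof -
  have "(n + n + 2) choose n > 0" by (rule zero_less_binomial) simp
  then show ?thesis by (simp add: jacobi_coeff_def)
qed

lemma jacobi_coeff_0: "jacobi_coeff n 0 = 1"
  by (simp add: jacobi_coeff_def)

text \<open>This is the recursion that the eigenvalue equation forces on the coefficients. Each
  binomial factor advances by an absorption identity, and the change of
  \<open>1 / real (k + 1)\<close> supplies the factor \<open>real k + 2\<close>.\<close>

lemma jacobi_coeff_Suc:
  "2 * (real k + 1) * (real k + 2) * jacobi_coeff n (Suc k)
     = - (real n - real k) * (real n + real k + 3) * jacobi_coeff n k"
proof -
  have 1: "(real k + 1) * real (n choose Suc k) = (real n - real k) * real (n choose k)"
  proof (cases "k \<le> n")
    case True
    have "Suc k * (n choose Suc k) = (n - k) * (n choose k)"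
      using binomial_absorb_comp[of n k] binomial_absorption[of k "n"] by simp
    then have "real (Suc k * (n choose Suc k)) = real ((n - k) * (n choose k))" by simp
    then show ?thesis using True by (simp add: of_nat_diff algebra_simps)
  qed (simp add: binomial_eq_0)
  have 2: "(real k + 1) * real ((n + Suc k + 2) choose Suc k)
      = (real n + real k + 3) * real ((n + k + 2) choose k)"
  proof -
    have "real (Suc (n + k + 2) * (n + k + 2 choose k)) = real ((Suc (n + k + 2) choose Suc k) * Suc k)"
      by (simp only: Suc_times_binomial_eq)
    then show ?thesis by (simp add: algebra_simps)
  qed
  define A B where "A = real (n choose Suc k)" and "B = real ((n + Suc k + 2) choose Suc k)"
  define C D where "C = real (n choose k)" and "D = real ((n + k + 2) choose k)"
  have k: "real k + 1 \<noteq> 0" "real k + 2 \<noteq> 0" by linarith+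
  have A: "A = (real n - real k) * C / (real k + 1)"
    using 1 k unfolding A_def C_def by (simp add: field_simps)
  have B: "B = (real n + real k + 3) * D / (real k + 1)"
    using 2 k unfolding B_def D_def by (simp add: field_simps)
  have "jacobi_coeff n (Suc k) = (-1/2)^k * (-1/2) * A * B / (real k + 2)"
    by (simp add: jacobi_coeff_def A_def B_def)
  moreover have "jacobi_coeff n k = (-1/2)^k * C * D / (real k + 1)"
    by (simp add: jacobi_coeff_def C_def D_def add.commute)
  ultimately show ?thesis
    using k unfolding A B by simp (simp add: algebra_simps diff_divide_distrib)
qed

text \<open>Coefficients are compared in the variable y = 1 - x, where
  \<open>jacobi_coeff_Suc\<close> is the required identity in each degree. Substituting back is
  harmless for a second derivative, since the two signs from the chain rule cancel.\<close>

lemma pderiv2_phi: "pderiv (pderiv (phi n)) = smult (- eigval n) (psi n)"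
proof -
  define Q where "Q = (\<Sum>k\<le>n. monom (jacobi_coeff n k) k)"
  have cQ: "coeff Q k = jacobi_coeff n k" for k
    by (simp add: Q_def coeff_sum jacobi_coeff_zero)
  \<comment> \<open>In y = 1 - x the weight 1 - x^2 reads 2 y - y^2.\<close>
  have phiQ: "phi n = pcompose ([:0, 2, -1:] * Q) [:1, -1:]"
    unfolding phi_def psi_def Q_def[symmetric] pcompose_mult by (simp add: pcompose_pCons)
  have "pderiv (pderiv ([:0, 2, -1:] * Q)) = smult (- eigval n) Q"
  proof (rule poly_eqI)
    fix k
    have "coeff (pderiv (pderiv ([:0, 2, -1:] * Q))) k
      = (real k + 1) * (real k + 2) * (2 * coeff Q (Suc k) - coeff Q k)"
      by (simp add: coeff_pderiv algebra_simps)
    also have "\<dots> = 2 * (real k + 1) * (real k + 2) * jacobi_coeff n (Suc k)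
        - (real k + 1) * (real k + 2) * jacobi_coeff n k"
      by (simp add: cQ algebra_simps)
    also have "\<dots> = - eigval n * jacobi_coeff n k"
      unfolding jacobi_coeff_Suc eigval_def by (simp add: algebra_simps)
    finally show "coeff (pderiv (pderiv ([:0, 2, -1:] * Q))) k = coeff (smult (- eigval n) Q) k"
      by (simp add: cQ)
  qed
  then show ?thesis
    by (simp add: phiQ pderiv_pcompose psi_def Q_def[symmetric] pderiv_mult pderiv_pCons
          pcompose_smult pderiv_smult pderiv_minus pcompose_uminus)
qed

section \<open>Values and growth on the closed interval\<close>

lemma poly_psi: "poly (psi n) x = (\<Sum>k\<le>n. jacobi_coeff n k * (1 - x)^k)"
  by (simp add: psi_def poly_pcompose poly_sum poly_monom)

lemma poly_phi: "poly (phi n) x = (1 - x\<^sup>2) * poly (psi n) x"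
  by (simp add: phi_def power2_eq_square algebra_simps)

lemma poly_psi_1: "poly (psi n) 1 = 1"
proof -
  have "poly (psi n) 1 = (\<Sum>k\<le>n. if k = 0 then jacobi_coeff n 0 else 0)"
    unfolding poly_psi by (intro sum.cong) auto
  then show ?thesis by (simp add: jacobi_coeff_0)
qed

lemma poly_pderiv_psi:
  "poly (pderiv (psi n)) x = - (\<Sum>k\<le>n. jacobi_coeff n k * (real k * (1 - x)^(k - 1)))"
proof (rule DERIV_unique)
  show "(poly (psi n) has_real_derivative poly (pderiv (psi n)) x) (at x)"
    by (rule poly_DERIV)
  have "((\<lambda>x. \<Sum>k\<le>n. jacobi_coeff n k * (1 - x)^k) has_real_derivative
     - (\<Sum>k\<le>n. jacobi_coeff n k * (real k * (1 - x)^(k - 1)))) (at x)"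
    by (auto intro!: derivative_eq_intros simp: sum_negf[symmetric] algebra_simps)
  then show "(poly (psi n) has_real_derivative
     - (\<Sum>k\<le>n. jacobi_coeff n k * (real k * (1 - x)^(k - 1)))) (at x)"
    by (simp add: poly_psi[abs_def])
qed

text \<open>The factor \<open>2^k\<close> anticipates \<bar>1 - x\<bar> \<le> 2 on [-1, 1].
  Binomials are bounded crudely by powers of 2, as only some exponential rate in \<open>n\<close>
  matters.\<close>

lemma jacobi_coeff_bound: "k \<le> n \<Longrightarrow> \<bar>jacobi_coeff n k\<bar> * 2^k \<le> 4 * 8^n"
proof -
  assume k: "k \<le> n"
  have "\<bar>jacobi_coeff n k\<bar> * 2^k = real (n choose k) * real ((n + k + 2) choose k) / real (k + 1)"
    by (simp add: jacobi_coeff_def abs_mult power_abs power_divide)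
  also have "\<dots> \<le> real (n choose k) * real ((n + k + 2) choose k)"
    using divide_left_mono[of 1 "real (k + 1)" "real (n choose k) * real ((n + k + 2) choose k)"]
    by simp
  also have "\<dots> \<le> 2^n * 2^(n + k + 2)"
  proof -
    have "real (n choose k) \<le> 2^n" "real ((n + k + 2) choose k) \<le> 2^(n + k + 2)"
      using binomial_le_pow2[of n k] binomial_le_pow2[of "n + k + 2" k]
      by (metis of_nat_le_iff of_nat_numeral of_nat_power)+
    then show ?thesis by (intro mult_mono) auto
  qed
  also have "\<dots> \<le> (2::real)^n * 2^(n + n + 2)"
    using k by (intro mult_left_mono power_increasing) auto
  also have "\<dots> = 4 * 8^n"
    by (simp add: power_add power_mult_distrib[symmetric])
  finally show ?thesis .
qed

lemma nat_le_pow2: "real n + 1 \<le> 2^n"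
  by (induction n) auto

lemma psi_bound: 
  assumes "x \<in> {-1..1}" 
  shows "\<bar>poly (psi n) x\<bar> \<le> 4 * 32^n" and "\<bar>poly (pderiv (psi n)) x\<bar> \<le> 4 * 32^n"
proof -
  have x: "\<bar>1 - x\<bar> \<le> 2" using assms by auto
  have t: "\<bar>jacobi_coeff n k * (1 - x)^k\<bar> \<le> 4 * 8^n" if "k \<le> n" for k
  proof -
    have "\<bar>jacobi_coeff n k * (1 - x)^k\<bar> \<le> \<bar>jacobi_coeff n k\<bar> * 2^k"
      unfolding abs_mult power_abs using x by (intro mult_left_mono power_mono) auto
    with jacobi_coeff_bound[OF that] show ?thesis by linarith
  qed
  have "\<bar>poly (psi n) x\<bar> \<le> (\<Sum>k\<le>n. 4 * 8^n)"
    unfolding poly_psi by (rule order_trans[OF sum_abs sum_mono]) (use t in auto)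
  also have "\<dots> = (real n + 1) * (4 * 8^n)" by simp
  also have "\<dots> \<le> 2^n * (4 * 8^n)" using nat_le_pow2 by (intro mult_right_mono) auto
  also have "\<dots> = 4 * 16^n" by (simp add: power_mult_distrib[symmetric])
  \<comment> \<open>Weakened to the base of the derivative bound, so that both bounds have the same
    form.\<close>
  also have "\<dots> \<le> 4 * (32::real)^n" by (simp add: power_mono)
  finally show "\<bar>poly (psi n) x\<bar> \<le> 4 * 32^n" .
  have t': "\<bar>jacobi_coeff n k * (real k * (1 - x)^(k-1))\<bar> \<le> 2^n * (4 * 8^n)" if "k \<le> n" for k
  proof -
    have "\<bar>jacobi_coeff n k * (real k * (1 - x)^(k-1))\<bar> \<le> \<bar>jacobi_coeff n k\<bar> * (real k * 2^(k-1))"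
      unfolding abs_mult power_abs using x by (intro mult_left_mono mult_mono power_mono) auto
    also have "\<dots> \<le> \<bar>jacobi_coeff n k\<bar> * (2^n * 2^k)"
    proof -
      have "real k \<le> 2^n" using nat_le_pow2[of n] that by linarith
      then show ?thesis by (intro mult_left_mono mult_mono power_increasing) auto
    qed
    also have "\<dots> = 2^n * (\<bar>jacobi_coeff n k\<bar> * 2^k)" by simp
    also have "\<dots> \<le> 2^n * (4 * 8^n)"
      using jacobi_coeff_bound[OF that] by (intro mult_left_mono) auto
    finally show ?thesis .
  qed
  have "\<bar>poly (pderiv (psi n)) x\<bar> \<le> (\<Sum>k\<le>n. 2^n * (4 * 8^n))"
    unfolding poly_pderiv_psi abs_minus_cancel
    by (rule order_trans[OF sum_abs sum_mono]) (use t' in auto)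
  also have "\<dots> = (real n + 1) * (2^n * (4 * 8^n))" by simp
  also have "\<dots> \<le> 2^n * (2^n * (4 * 8^n))" using nat_le_pow2 by (intro mult_right_mono) auto
  also have "\<dots> = 4 * 32^n" by (simp add: power_mult_distrib[symmetric])
  finally show "\<bar>poly (pderiv (psi n)) x\<bar> \<le> 4 * 32^n" .
qed

lemma phi_bound:
  assumes "x \<in> {-1..1}" 
  shows "\<bar>poly (phi n) x\<bar> \<le> 4 * 32^n" and "\<bar>poly (pderiv (phi n)) x\<bar> \<le> 12 * 32^n"
proof -
  have x: "\<bar>1 - x\<^sup>2\<bar> \<le> 1" "\<bar>2 * x\<bar> \<le> 2"
    using assms abs_square_le_1[of x] by auto
  show "\<bar>poly (phi n) x\<bar> \<le> 4 * 32^n"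
    unfolding poly_phi abs_mult using psi_bound(1)[OF assms, of n] x mult_mono[of "\<bar>1 - x\<^sup>2\<bar>" 1 "\<bar>poly (psi n) x\<bar>" "4 * 32^n"]
    by auto
  have "poly (pderiv (phi n)) x = (1 - x\<^sup>2) * poly (pderiv (psi n)) x - (2 * x) * poly (psi n) x"
    unfolding phi_def pderiv_mult by (simp add: pderiv_pCons power2_eq_square algebra_simps)
  moreover have "\<bar>(1 - x\<^sup>2) * poly (pderiv (psi n)) x\<bar> \<le> 1 * (4 * 32^n)"
    unfolding abs_mult using psi_bound(2)[OF assms, of n] x by (intro mult_mono) auto
  moreover have "\<bar>(2 * x) * poly (psi n) x\<bar> \<le> 2 * (4 * 32^n)"
    unfolding abs_mult[of "2 * x"] using psi_bound(1)[OF assms, of n] x by (intro mult_mono) auto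
  ultimately show "\<bar>poly (pderiv (phi n)) x\<bar> \<le> 12 * 32^n" by linarith
qed

lemma phi_boundary [simp]: "poly (phi n) 1 = 0" "poly (phi n) (-1) = 0"
  by (simp_all add: poly_phi)

section \<open>Orthogonality and the normalising integrals\<close>

lemma poly_continuous_on: "continuous_on A (poly p)" for p :: "real poly"
  by (intro continuous_intros)

lemma poly_integrable: "poly (p :: real poly) integrable_on {a..b}"
  by (intro integrable_continuous_real poly_continuous_on)

lemma poly_FTC:
  "a \<le> b \<Longrightarrow> (poly (pderiv F) has_integral (poly F b - poly F a)) {a..b}" for F :: "real poly"
  by (intro fundamental_theorem_of_calculus)
     (auto intro: has_field_derivative_at_within[OF poly_DERIV]
           simp: has_real_derivative_iff_has_vector_derivative[symmetric])

text \<open>Lagrange's identity: the Wronskian of \<open>phi m\<close> and \<open>phi n\<close>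
  vanishes at both endpoints, and by \<open>pderiv2_phi\<close> its derivative is
  \<open>eigval m - eigval n\<close> times \<open>phi m * psi n\<close>.\<close>

lemma psi_orthogonal:
  assumes "m \<noteq> n" shows "integral {-1..1} (poly (phi m * psi n)) = 0"
proof -
  let ?F = "phi m * pderiv (phi n) - pderiv (phi m) * phi n"
  have "(poly (pderiv ?F) has_integral (poly ?F 1 - poly ?F (-1))) {-1..1}"
    by (rule poly_FTC) simp
  moreover have "pderiv ?F = smult (eigval m - eigval n) (phi m * psi n)"
  proof -
    have "pderiv ?F = phi m * smult (- eigval n) (psi n) - smult (- eigval m) (psi m) * phi n"
      by (simp add: pderiv_diff pderiv_mult pderiv2_phi mult.commute)
    also have "\<dots> = smult (eigval m) (phi m * psi n) - smult (eigval n) (phi m * psi n)"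
    proof -
      have "psi m * phi n = phi m * psi n" unfolding phi_def by (simp only: mult_ac)
      then show ?thesis by simp
    qed
    finally show ?thesis by (simp add: smult_diff_left)
  qed
  ultimately have "(poly (smult (eigval m - eigval n) (phi m * psi n)) has_integral 0) {-1..1}" by simp
  then have "integral {-1..1} (\<lambda>x. (eigval m - eigval n) * poly (phi m * psi n) x) = 0"
    unfolding poly_smult[abs_def] by (rule integral_unique)
  then have "(eigval m - eigval n) * integral {-1..1} (poly (phi m * psi n)) = 0"
    by (simp only: integral_mult_right)
  then show ?thesis using eigval_inj[of m n] assms by auto
qed

text \<open>The square of the norm of \<open>phi n\<close> in the space with weight 1 / (1 -
  x^2).\<close>

definition psi_norm :: "nat \<Rightarrow> real" where
  "psi_norm n = integral {-1..1} (poly (phi n * psi n))"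

text \<open>Since \<open>\<psi>\<^sub>n(1) = 1\<close> and \<open>\<psi>\<^sub>n'\<close> is at most \<open>K = 4 * 32^n\<close>, \<open>\<psi>\<^sub>n \<ge> 1/2\<close> on an interval of length \<open>1 / (2 K)\<close> next to 1.\<close>

lemma psi_norm_lower: "1 / (1024 * 1024^n) \<le> psi_norm n"
proof -
  define K :: real where "K = 4 * 32^n"
  have K: "K \<ge> 4" unfolding K_def by simp
  \<comment> \<open>Staying within 1/(2K) of 1 keeps \<open>psi n\<close> above 1/2, while staying
    at least 1/(4K) away from 1 keeps 1 - x^2 above 1/(4K).\<close>
  define a b where "a = 1 - 1/(2*K)" and "b = 1 - 1/(4*K)"
  have ab: "a < b" "-1 < a" "b < 1" "b - a = 1/(4*K)" 
    using K by (auto simp: a_def b_def field_simps)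
  have sub: "{a..b} \<subseteq> {-1..1}" using ab by auto
  have low: "1/(16*K) \<le> poly (phi n * psi n) x" if "x \<in> {a..b}" for x
  proof -
    have x: "x < 1" "x \<in> {-1..1}" "1/(4*K) \<le> 1 - x" "1 - x \<le> 1/(2*K)" "0 \<le> x"
    proof -
      have "1/(2*K) \<le> 1/8" "1/(4*K) > 0" using K by (auto simp: field_simps)
      moreover have "a \<le> x" "x \<le> b" using that by auto
      moreover have "1/(4*K) \<le> 1 - x" "1 - x \<le> 1/(2*K)" using that by (auto simp: a_def b_def)
      ultimately show "x < 1" "x \<in> {-1..1}" "1/(4*K) \<le> 1 - x" "1 - x \<le> 1/(2*K)" "0 \<le> x"
        unfolding atLeastAtMost_iff by linarith+
    qed
    obtain y where y: "x < y" "y < 1" "poly (psi n) 1 - poly (psi n) x = (1 - x) * poly (pderiv (psi n)) y"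
      using poly_MVT[OF x(1), of "psi n"] by auto
    have "\<bar>(1 - x) * poly (pderiv (psi n)) y\<bar> \<le> (1/(2*K)) * K"
      unfolding abs_mult using x y psi_bound(2)[of y n] by (intro mult_mono) (auto simp: K_def)
    also have "\<dots> = 1/2" using K by simp
    finally have p: "poly (psi n) x \<ge> 1/2" using y(3) poly_psi_1[of n] by auto
    have "1/(4*K) \<le> (1 - x) * (1 + x)" using x mult_mono[of "1/(4*K)" "1 - x" 1 "1 + x"] K by simp
    then have q: "1/(4*K) \<le> 1 - x\<^sup>2" by (simp add: power2_eq_square algebra_simps)
    have "1/(16*K) = 1/(4*K) * (1/2 * (1/2))" by simp
    also have "\<dots> \<le> (1 - x\<^sup>2) * (poly (psi n) x * poly (psi n) x)"
      using p q K by (intro mult_mono order_trans[OF _ q]) auto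
    finally show ?thesis by (simp add: poly_phi mult.assoc)
  qed
  have nonneg: "0 \<le> poly (phi n * psi n) x" if "x \<in> {-1..1}" for x
    using that abs_square_le_1[of x] by (auto simp: poly_phi mult.assoc)
  have "1 / (1024 * 1024^n) = integral {a..b} (\<lambda>x. 1/(16*K))"
  proof -
    have "integral {a..b} (\<lambda>x. 1/(16*K)) = 1/(64 * K\<^sup>2)" 
      using ab(1) by (simp add: content_real ab(4) power2_eq_square)
    also have "\<dots> = 1 / (1024 * 1024^n)"
      by (simp add: K_def power2_eq_square flip: power_mult_distrib)
    finally show ?thesis by simp
  qed
  also have "\<dots> \<le> integral {a..b} (poly (phi n * psi n))"
    by (intro integral_le poly_integrable low) auto
  also have "\<dots> \<le> psi_norm n" unfolding psi_norm_def
    by (intro integral_subset_le poly_integrable sub ballI nonneg)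
  finally show ?thesis .
qed

lemma psi_norm_pos: "psi_norm n > 0"
  by (rule less_le_trans[OF _ psi_norm_lower]) simp

lemma inverse_psi_norm_le: "1 / psi_norm n \<le> 1024 * 1024^n"
  using psi_norm_lower[of n] psi_norm_pos[of n] by (simp add: field_simps)

section \<open>Expansion of polynomials in the eigenpolynomials\<close>

lemma degree_psi: "degree (psi n) = n"
proof -
  define Q where "Q = (\<Sum>k\<le>n. monom (jacobi_coeff n k) k)"
  have cQ: "coeff Q k = jacobi_coeff n k" for k
    by (simp add: Q_def coeff_sum jacobi_coeff_zero)
  have "degree Q = n"
  proof (rule antisym)
    show "degree Q \<le> n" by (rule degree_le) (simp add: cQ jacobi_coeff_zero)
    show "n \<le> degree Q" by (rule le_degree) (simp add: cQ jacobi_coeff_self_nonzero)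
  qed
  then show ?thesis by (simp add: psi_def Q_def[symmetric] degree_pcompose)
qed

text \<open>Since \<open>psi N\<close> has exact degree \<open>N\<close>, a multiple of it cancels
  the coefficient of degree \<open>N\<close>, and induction treats the remainder.\<close>

lemma poly_in_span_psi: "degree q < N \<Longrightarrow> \<exists>a. q = (\<Sum>n<N. smult (a n) (psi n))" for q :: "real poly"
proof (induction N arbitrary: q)
  case (Suc N)
  define c where "c = coeff q N / coeff (psi N) N"
  have nz: "coeff (psi N) N \<noteq> 0" 
    by (metis degree_psi leading_coeff_0_iff poly_0 poly_psi_1 zero_neq_one)
  define r where "r = q - smult c (psi N)"
  have cr: "coeff r k = 0" if "k \<ge> N" for k
  proof (cases "k = N")
    case True then show ?thesis using nz by (simp add: r_def c_def)
  next
    case False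
    then have "degree q < k" "degree (psi N) < k" using that Suc.prems by (auto simp: degree_psi)
    then show ?thesis by (simp add: r_def coeff_eq_0)
  qed
  show ?case
  \<comment> \<open>For \<open>N = 0\<close> the remainder is zero but still has degree 0, so the
    induction hypothesis, which asks for degree below 0, cannot be applied.\<close>
  proof (cases "N = 0")
    case True
    then have "r = 0" using cr by (intro poly_eqI) simp
    then show ?thesis using True by (intro exI[of _ "\<lambda>_. c"]) (simp add: r_def)
  next
    case False
    have "degree r \<le> N - 1" by (rule degree_le) (use cr False in auto)
    with False have "degree r < N" by linarith
    from Suc.IH[OF this] obtain a where a: "r = (\<Sum>n<N. smult (a n) (psi n))" by blast
    show ?thesis 
      by (intro exI[of _ "a(N := c)"]) (simp add: a[symmetric], simp add: r_def)
  qed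
qed simp

section \<open>Bump functions and uniqueness of weak derivatives\<close>

text \<open>Smoothness by closure: a family that contains a derivative of each of its members
  contains all iterated derivatives. No formula for the n-th derivative is then required.\<close>

lemma smooth_funI:
  assumes "f \<in> S" and "\<And>g. g \<in> S \<Longrightarrow> \<exists>g'\<in>S. \<forall>x. (g has_real_derivative g' x) (at x)"
  shows "smooth_fun f"
proof -
  have "(deriv ^^ n) f \<in> S" for n
  proof (induction n)
    case (Suc n)
    from assms(2)[OF this] obtain g' where g': "g' \<in> S" "\<forall>x. ((deriv ^^ n) f has_real_derivative g' x) (at x)"
      by blast
    then have "deriv ((deriv ^^ n) f) = g'"
      by (intro ext DERIV_imp_deriv) auto
    with g'(1) show ?case by simp
  qed (use assms(1) in simp)
  then show ?thesis
    unfolding smooth_fun_def using assms(2) real_differentiable_def by blast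
qed

lemma smooth_fun_DERIV: "smooth_fun f \<Longrightarrow> (f has_real_derivative deriv f x) (at x)"
  unfolding smooth_fun_def using DERIV_deriv_iff_real_differentiable by (metis funpow_0)

lemma smooth_fun_continuous: "smooth_fun f \<Longrightarrow> continuous_on A f"
  by (meson smooth_fun_DERIV DERIV_continuous continuous_at_imp_continuous_on)

lemma smooth_fun_deriv: "smooth_fun f \<Longrightarrow> smooth_fun (deriv f)"
  unfolding smooth_fun_def by (metis funpow_Suc_right comp_apply)

text \<open>The parameters \<open>p\<close> and \<open>k\<close> make the family closed under differentiation; the test functions are the
  members with \<open>p = 1\<close>, \<open>k = 0\<close>, which tend to the indicator of the interval as \<open>m \<rightarrow> 0\<close>.\<close>

definition bump :: "real \<Rightarrow> real \<Rightarrow> real \<Rightarrow> real poly \<Rightarrow> nat \<Rightarrow> real \<Rightarrow> real" where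
  "bump a b m p k x = (if a < x \<and> x < b
     then poly p x * (1 / ((x - a) * (b - x)))^k * exp (- (m / ((x - a) * (b - x)))) else 0)"

text \<open>The exponential dominates the single term \<open>(m * y)^k / fact k\<close> of its
  series.\<close>

lemma power_exp_bounded:
  fixes m :: real assumes "m > 0"
  shows "\<exists>B. \<forall>y\<ge>0. y^k * exp (- (m * y)) \<le> B"
proof (intro exI allI impI)
  fix y :: real assume y: "y \<ge> 0"
  have "(m * y)^k / fact k \<le> exp (m * y)"
  proof -
    have "(\<Sum>n\<in>{k}. (m * y)^n /\<^sub>R fact n) \<le> exp (m * y)"
      unfolding exp_def using y assms by (intro sum_le_suminf summable_exp_generic) auto
    then show ?thesis by (simp add: divide_inverse mult.commute)
  qed
  then show "y^k * exp (- (m * y)) \<le> fact k / m^k"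
    using assms by (simp add: exp_minus field_simps)
qed

text \<open>With s = (x - a)(b - x) and y = 1/s, applying \<open>power_exp_bounded\<close> to the
  exponent \<open>k + 2\<close> leaves a spare factor s^2. Quadratic vanishing at the ends is what
  gives the derivative 0 there.\<close>

lemma bump_quadratic_bound:
  assumes "m > 0"
  shows "\<exists>C\<ge>0. \<forall>x. \<bar>bump a b m p k x\<bar> \<le> C * ((x - a) * (b - x))\<^sup>2"
proof -
  obtain B where B: "\<And>y. y \<ge> 0 \<Longrightarrow> y^(k+2) * exp (- (m * y)) \<le> B"
    using power_exp_bounded[OF assms] by metis
  have "B \<ge> 0" using B[of 0] by simp
  have "bounded (poly p ` {a..b})"
    by (intro compact_imp_bounded compact_continuous_image continuous_intros) auto
  then obtain P where P: "\<And>x. x \<in> {a..b} \<Longrightarrow> \<bar>poly p x\<bar> \<le> P" "P \<ge> 0"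
    unfolding bounded_pos by (metis imageI less_imp_le real_norm_def)
  have "\<bar>bump a b m p k x\<bar> \<le> (P * B) * ((x - a) * (b - x))\<^sup>2" for x
  proof (cases "a < x \<and> x < b")
    case True
    define s where "s = (x - a) * (b - x)"
    have s: "s > 0" using True by (simp add: s_def)
    have "\<bar>bump a b m p k x\<bar> = \<bar>poly p x\<bar> * ((1/s)^k * exp (- (m * (1/s))))"
      using True s by (simp add: bump_def s_def[symmetric] abs_mult)
    also have "\<dots> = \<bar>poly p x\<bar> * ((1/s)^(k+2) * exp (- (m * (1/s)))) * s\<^sup>2"
      using s by (simp add: power_add power_divide field_simps power2_eq_square)
    also have "\<dots> \<le> (P * B) * s\<^sup>2"
      using P True s B[of "1/s"] \<open>B \<ge> 0\<close> by (intro mult_right_mono mult_mono) auto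
    finally show ?thesis by (simp add: s_def)
  next
    case False
    then show ?thesis using P(2) \<open>B \<ge> 0\<close> by (auto simp: bump_def)
  qed
  then show ?thesis using P(2) \<open>B \<ge> 0\<close> by (intro exI[of _ "P * B"]) auto
qed

text \<open>The difference quotient at \<open>a\<close> is of order \<bar>x - a\<bar>. The factor
  \<open>g\<close> absorbs the contribution of the opposite endpoint, so that the lemma applies at
  either end of a bump.\<close>

lemma DERIV_zero_of_quadratic_bound:
  fixes f :: "real \<Rightarrow> real"
  assumes "\<And>x. \<bar>f x\<bar> \<le> C * (x - a)\<^sup>2 * (g x)\<^sup>2" and "isCont g a"
  shows "(f has_real_derivative 0) (at a)"
proof -
  have fa: "f a = 0" using assms(1)[of a] by simp
  have "((\<lambda>x. f x / (x - a)) \<longlongrightarrow> 0) (at a)"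
  proof (rule Lim_null_comparison)
    show "\<forall>\<^sub>F x in at a. norm (f x / (x - a)) \<le> C * \<bar>x - a\<bar> * (g x)\<^sup>2"
    proof (rule eventually_at_filter[THEN iffD2], rule always_eventually, intro allI impI)
      fix x assume "x \<noteq> a"
      then have p: "\<bar>x - a\<bar> > 0" by simp
      have "\<bar>f x\<bar> \<le> C * \<bar>x - a\<bar> * (g x)\<^sup>2 * \<bar>x - a\<bar>"
        using assms(1)[of x] by (simp add: power2_eq_square mult_ac flip: abs_mult)
      then show "norm (f x / (x - a)) \<le> C * \<bar>x - a\<bar> * (g x)\<^sup>2"
        using p by (simp add: abs_divide pos_divide_le_eq)
    qed
    have "((\<lambda>x. C * \<bar>x - a\<bar> * (g x)\<^sup>2) \<longlongrightarrow> C * \<bar>a - a\<bar> * (g a)\<^sup>2) (at a)"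
      using assms(2) unfolding isCont_def by (intro tendsto_intros) auto
    then show "((\<lambda>x. C * \<bar>x - a\<bar> * (g x)\<^sup>2) \<longlongrightarrow> 0) (at a)" by simp
  qed
  then show ?thesis by (simp add: has_field_derivative_iff fa)
qed

lemma bump_DERIV:
  assumes "m > 0" "a < b"
  shows "\<exists>q. \<forall>x. (bump a b m p k has_real_derivative bump a b m q (k + 2) x) (at x)"
proof -
  define s :: "real poly" where "s = [:-a, 1:] * [:b, -1:]"
  have s: "poly s x = (x - a) * (b - x)" for x by (simp add: s_def algebra_simps)
  \<comment> \<open>The numerator left after 1/s^(k + 2) is pulled out of the derivative: the three
    terms come from \<open>p\<close>, from the power of 1/s and from the exponential.\<close>
  define q where "q = pderiv p * s * s - smult (real k) (p * pderiv s * s) + smult m (p * pderiv s)"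
  have "(bump a b m p k has_real_derivative bump a b m q (k + 2) x) (at x)" for x
  proof -
    consider (inside) "a < x" "x < b" | (out) "x < a \<or> x > b" | (bd) "x = a \<or> x = b" by linarith
    then show ?thesis
    proof cases
      case inside
      then have sx: "poly s x > 0" by (simp add: s)
      have "((\<lambda>x. poly p x * (1 / poly s x)^k * exp (- (m / poly s x))) has_real_derivative
          poly q x * (1 / poly s x)^(k+2) * exp (- (m / poly s x))) (at x)"
      proof (cases k)
        case 0
        show ?thesis using sx unfolding 0
          by (auto intro!: derivative_eq_intros poly_DERIV simp: q_def 0 field_simps power2_eq_square)
      next
        case (Suc j)
        show ?thesis using sx unfolding Suc
          by (auto intro!: derivative_eq_intros poly_DERIV simp: q_def Suc field_simps power2_eq_square)
             (metis One_nat_def mult.commute power_minus_mult)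
      qed
      then have "((\<lambda>x. poly p x * (1 / poly s x)^k * exp (- (m / poly s x))) has_real_derivative
          bump a b m q (k + 2) x) (at x)"
        using inside by (simp add: bump_def s)
      then show ?thesis
        by (rule has_field_derivative_transform_within_open[of _ _ _ "{a<..<b}"])
           (use inside in \<open>auto simp: bump_def s\<close>)
    next
      case out
      have "((\<lambda>_. 0) has_real_derivative bump a b m q (k + 2) x) (at x)"
        using out by (auto simp: bump_def)
      then show ?thesis
        by (rule has_field_derivative_transform_within_open[of _ _ _ "- {a..b}"])
           (use out in \<open>auto simp: bump_def\<close>)
    next
      case bd
      obtain C where C: "\<And>x. \<bar>bump a b m p k x\<bar> \<le> C * ((x - a) * (b - x))\<^sup>2"
        using bump_quadratic_bound[OF assms(1)] by metis
      have "(bump a b m p k has_real_derivative 0) (at x)"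
        using bd
      proof
        assume "x = a"
        show ?thesis unfolding \<open>x = a\<close>
          by (rule DERIV_zero_of_quadratic_bound[where g = "\<lambda>x. b - x" and C = C])
             (use C in \<open>auto simp: power_mult_distrib mult_ac intro!: continuous_intros\<close>)
      next
        assume "x = b"
        show ?thesis unfolding \<open>x = b\<close>
          by (rule DERIV_zero_of_quadratic_bound[where g = "\<lambda>x. x - a" and C = C])
             (use C in \<open>auto simp: power_mult_distrib mult_ac power2_commute[of b] intro!: continuous_intros\<close>)
      qed
      then show ?thesis using bd by (auto simp: bump_def)
    qed
  qed
  then show ?thesis by blast
qed

lemma smooth_fun_bump: "m > 0 \<Longrightarrow> a < b \<Longrightarrow> smooth_fun (bump a b m p k)"
  by (rule smooth_funI[where S = "{bump a b m q j | q j. True}"]) (use bump_DERIV in blast)+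

lemma test_fun_x_bump:
  assumes "m > 0" "-1 < a" "a < b" "b < 1"
  shows "test_fun_x (bump a b m 1 0)"
  unfolding test_fun_x_def using assms smooth_fun_bump[of m a b 1 0]
  by (intro conjI exI[of _ a] exI[of _ b]) (auto simp: bump_def)

lemma bump_bounds: "m > 0 \<Longrightarrow> 0 \<le> bump a b m 1 0 x \<and> bump a b m 1 0 x \<le> 1"
  by (auto simp: bump_def)

lemma bump_tendsto_indicator:
  "(\<lambda>n. bump a b (1 / real (Suc n)) 1 0 x) \<longlonglongrightarrow> indicator {a<..<b} x"
proof (cases "a < x \<and> x < b")
  case True
  have "(\<lambda>n. exp (- (1 / real (Suc n) * (1 / ((x - a) * (b - x)))))) \<longlonglongrightarrow> exp (- (0 * (1 / ((x - a) * (b - x)))))"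
    by (intro tendsto_intros) (rule LIMSEQ_Suc[OF lim_1_over_n])
  then show ?thesis using True by (simp add: bump_def)
qed (auto simp: bump_def)

section \<open>From vanishing test integrals to vanishing functions\<close>

lemma set_integral_zero_of_test_fun:
  assumes loc: "loc_int g"
    and zero: "\<And>\<phi>. test_fun_x \<phi> \<Longrightarrow> (LINT x:Ioo11|lborel. g x * \<phi> x) = 0"
    and ab: "-1 < a" "a < b" "b < 1"
  shows "(LINT x:{a..b}|lborel. g x) = 0"
proof -
  let ?f = "\<lambda>x. indicator {a..b} x *\<^sub>R g x"
  have int: "integrable lborel ?f"
    using loc ab unfolding loc_int_def set_integrable_def by auto
  have eq: "(LINT x|lborel. ?f x * bump a b (1 / real (Suc n)) 1 0 x) = 0" for n
  proof -
    have "(LINT x|lborel. ?f x * bump a b (1 / real (Suc n)) 1 0 x)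
        = (LINT x:Ioo11|lborel. g x * bump a b (1 / real (Suc n)) 1 0 x)"
      unfolding set_lebesgue_integral_def using ab
      by (intro Bochner_Integration.integral_cong) (auto simp: bump_def indicator_def)
    also have "\<dots> = 0" using ab by (intro zero test_fun_x_bump) auto
    finally show ?thesis .
  qed
  \<comment> \<open>The bumps lie between 0 and 1 and tend to the indicator of the open interval, so
    \<bar>\<open>?f\<close>\<bar> dominates. The two missing endpoints form a null set.\<close>
  have "(\<lambda>n. LINT x|lborel. ?f x * bump a b (1 / real (Suc n)) 1 0 x)
      \<longlonglongrightarrow> (LINT x|lborel. ?f x * indicator {a<..<b} x)"
  proof (rule integral_dominated_convergence[where w = "\<lambda>x. norm (?f x)"])
    have [measurable]: "bump a b (1 / real (Suc n)) 1 0 \<in> borel_measurable lborel" for n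
      using smooth_fun_continuous[OF smooth_fun_bump[of "1 / real (Suc n)" a b 1 0], of UNIV] ab
      by (auto intro!: borel_measurable_continuous_onI)
    have [measurable]: "?f \<in> borel_measurable lborel" using int by auto
    show "(\<lambda>x. ?f x * indicator {a<..<b} x) \<in> borel_measurable lborel" by measurable
    show "(\<lambda>x. ?f x * bump a b (1 / real (Suc n)) 1 0 x) \<in> borel_measurable lborel" for n
      by measurable
    show "AE x in lborel. norm (?f x * bump a b (1 / real (Suc n)) 1 0 x) \<le> norm (?f x)" for n
    proof (rule AE_I2)
      fix x
      have "\<bar>bump a b (1 / real (Suc n)) 1 0 x\<bar> \<le> 1"
        using bump_bounds[of "1 / real (Suc n)" a b x] by auto
      then show "norm (?f x * bump a b (1 / real (Suc n)) 1 0 x) \<le> norm (?f x)"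
        unfolding norm_mult by (intro mult_right_le_one_le) auto
    qed
    show "AE x in lborel. (\<lambda>n. ?f x * bump a b (1 / real (Suc n)) 1 0 x) \<longlonglongrightarrow> ?f x * indicator {a<..<b} x"
      by (intro AE_I2 tendsto_mult tendsto_const bump_tendsto_indicator)
  qed (use int in auto)
  then have "(LINT x|lborel. ?f x * indicator {a<..<b} x) = 0"
    unfolding eq by (simp add: LIMSEQ_const_iff)
  moreover have "(LINT x|lborel. ?f x * indicator {a<..<b} x) = (LINT x|lborel. ?f x)"
  proof (rule integral_cong_AE)
    have [measurable]: "?f \<in> borel_measurable lborel" using int by auto
    show "(\<lambda>x. ?f x * indicator {a<..<b} x) \<in> borel_measurable lborel" by measurable
    have "AE x in lborel. x \<noteq> a \<and> x \<noteq> b"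
      using AE_lborel_singleton[of a] AE_lborel_singleton[of b] by eventually_elim auto
    then show "AE x in lborel. ?f x * indicator {a<..<b} x = ?f x"
      by eventually_elim (auto simp: indicator_def)
  qed (use int in auto)
  ultimately show ?thesis by (simp add: set_lebesgue_integral_def)
qed

text \<open>Lebesgue differentiation: at almost every point \<open>f\<close> is the limit of its
  averages over [x, x + h], and for small h these are all 0.\<close>

lemma AE_zero_of_interval_integrals:
  fixes f :: "real \<Rightarrow> real"
  assumes int: "set_integrable lborel {c..d} f"
    and zero: "\<And>a b. c \<le> a \<Longrightarrow> a < b \<Longrightarrow> b \<le> d \<Longrightarrow> (LINT x:{a..b}|lborel. f x) = 0"
  shows "AE x in lborel. x \<in> {c<..<d} \<longrightarrow> f x = 0"
proof -
  \<comment> \<open>Extension by 0 makes the function integrable over every interval, as the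
    differentiation theorem asks.\<close>
  let ?f = "\<lambda>x. if x \<in> {c..d} then f x else 0"
  have "integrable lborel ?f"
    using int unfolding set_integrable_def
    by (rule Bochner_Integration.integrable_cong[THEN iffD1, rotated 2]) auto
  then have fi: "?f integrable_on cbox a b" for a b
    using integrable_on_lborel integrable_on_subcbox by blast
  obtain N where N: "negligible N" 
    and lim: "\<And>x e. \<lbrakk>x \<notin> N; 0 < e\<rbrakk> \<Longrightarrow> \<exists>\<delta>>0. \<forall>h. 0 < h \<and> h < \<delta> \<longrightarrow>
       norm (integral (cbox x (x + h *\<^sub>R One)) ?f /\<^sub>R h ^ DIM(real) - ?f x) < e"
    using integrable_ccontinuous_explicit[of ?f] fi by blast
  have "f x = 0" if x: "x \<in> {c<..<d}" "x \<notin> N" for x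
  proof (rule ccontr)
    assume "f x \<noteq> 0"
    then obtain \<delta> where \<delta>: "\<delta> > 0" and
      H: "\<And>h. 0 < h \<Longrightarrow> h < \<delta> \<Longrightarrow> \<bar>integral {x..x + h} ?f / h - f x\<bar> < \<bar>f x\<bar>"
      using lim[OF x(2), of "\<bar>f x\<bar>"] x(1) by (auto simp: divide_inverse mult.commute)
    define h where "h = min (\<delta>/2) ((d - x)/2)"
    have h: "0 < h" "h < \<delta>" "x + h \<le> d" using \<delta> x(1) by (auto simp: h_def min_def field_simps)
    have sub: "{x..x+h} \<subseteq> {c..d}" using h x(1) by auto
    have "integral {x..x+h} ?f = integral {x..x+h} f"
      using sub by (intro integral_cong) auto
    also have "\<dots> = (LINT y:{x..x+h}|lborel. f y)"
      using set_borel_integral_eq_integral(2)[OF set_integrable_subset[OF int _ sub]] by simp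
    also have "\<dots> = 0" using h x(1) by (intro zero) auto
    finally show False using H[OF h(1,2)] by simp
  qed
  then have "{x. \<not> (x \<in> {c<..<d} \<longrightarrow> f x = 0)} \<subseteq> N" by blast
  then have "AE x in lebesgue. x \<in> {c<..<d} \<longrightarrow> f x = 0"
    using N by (auto simp: negligible_iff_null_sets intro: AE_I'[of N])
  then show ?thesis by (simp add: AE_completion_iff)
qed

text \<open>The difference of two weak derivatives annihilates every test function, so its integrals
  over compact subintervals of \<open>Ioo11\<close> vanish. Local integrability forces the argument
  onto such subintervals, countably many of which exhaust \<open>Ioo11\<close>.\<close>

lemma weak_deriv_unique:
  assumes "weak_deriv f g" "weak_deriv f h"
  shows "AE x in lborel. x \<in> Ioo11 \<longrightarrow> g x = h x"
proof -
  let ?d = "\<lambda>x. g x - h x"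
  have gh: "loc_int g" "loc_int h" using assms by (auto simp: weak_deriv_def)
  then have loc: "loc_int ?d" by (auto simp: loc_int_def intro: set_integral_diff)
  \<comment> \<open>The integral of the difference may be split only if both products are
    integrable; the compact support of the test function turns local into global
    integrability.\<close>
  have prod_int: "set_integrable lborel Ioo11 (\<lambda>x. k x * \<phi> x)" if "loc_int k" "test_fun_x \<phi>" for k \<phi>
  proof -
    from that(2) obtain a b where ab: "-1 < a" "b < 1" "\<And>x. x \<notin> {a..b} \<Longrightarrow> \<phi> x = 0" and sm: "smooth_fun \<phi>"
      unfolding test_fun_x_def by blast
    have "bounded (\<phi> ` {a..b})"
      by (intro compact_imp_bounded compact_continuous_image smooth_fun_continuous sm) auto
    then obtain P where P: "\<And>x. x \<in> {a..b} \<Longrightarrow> \<bar>\<phi> x\<bar> \<le> P"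
      unfolding bounded_pos by (metis imageI real_norm_def)
    have k: "integrable lborel (\<lambda>x. indicator {a..b} x *\<^sub>R k x)"
      using that(1) ab by (auto simp: loc_int_def set_integrable_def)
    have "integrable lborel (\<lambda>x. (indicator {a..b} x *\<^sub>R k x) * \<phi> x)"
    proof (rule Bochner_Integration.integrable_bound[OF integrable_mult_right[OF integrable_norm[OF k], of P]])
      have [measurable]: "(\<lambda>x. indicator {a..b} x *\<^sub>R k x) \<in> borel_measurable lborel" using k by auto
      have [measurable]: "\<phi> \<in> borel_measurable lborel"
        using smooth_fun_continuous[OF sm, of UNIV] by (simp add: borel_measurable_continuous_onI)
      show "(\<lambda>x. indicator {a..b} x *\<^sub>R k x * \<phi> x) \<in> borel_measurable lborel" by measurable
      show "AE x in lborel. norm (indicator {a..b} x *\<^sub>R k x * \<phi> x) \<le> norm (P * norm (indicator {a..b} x *\<^sub>R k x))"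
      proof (rule AE_I2)
        fix x
        show "norm (indicator {a..b} x *\<^sub>R k x * \<phi> x) \<le> norm (P * norm (indicator {a..b} x *\<^sub>R k x))"
        proof (cases "x \<in> {a..b}")
          case True
          then show ?thesis using mult_right_mono[OF order_trans[OF P[OF True] abs_ge_self], of "\<bar>k x\<bar>"]
            by (simp add: abs_mult mult.commute)
        qed simp
      qed
    qed
    also have "(\<lambda>x. (indicator {a..b} x *\<^sub>R k x) * \<phi> x) = (\<lambda>x. indicator Ioo11 x *\<^sub>R (k x * \<phi> x))"
      using ab by (auto simp: indicator_def fun_eq_iff)
    finally show ?thesis by (simp add: set_integrable_def)
  qed
  have zero: "(LINT x:Ioo11|lborel. ?d x * \<phi> x) = 0" if "test_fun_x \<phi>" for \<phi>
  proof -
    have "(LINT x:Ioo11|lborel. ?d x * \<phi> x)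
        = (LINT x:Ioo11|lborel. g x * \<phi> x) - (LINT x:Ioo11|lborel. h x * \<phi> x)"
      using prod_int[OF gh(1) that] prod_int[OF gh(2) that] 
      by (simp add: left_diff_distrib set_integral_diff)
    also have "\<dots> = 0" using assms that by (auto simp: weak_deriv_def)
    finally show ?thesis .
  qed
  have ae: "AE x in lborel. x \<in> {-1 + 1/real (n+2)<..<1 - 1/real (n+2)} \<longrightarrow> ?d x = 0" for n
  proof (rule AE_zero_of_interval_integrals)
    show "set_integrable lborel {-1 + 1/real (n+2)..1 - 1/real (n+2)} ?d"
      using loc unfolding loc_int_def by auto
    show "(LINT x:{a..b}|lborel. ?d x) = 0" 
      if "-1 + 1/real (n+2) \<le> a" "a < b" "b \<le> 1 - 1/real (n+2)" for a b
    proof (rule set_integral_zero_of_test_fun[OF loc zero])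
      have "1/real (n+2) > 0" by simp
      then show "-1 < a" "b < 1" using that by linarith+
    qed (use that in auto)
  qed
  then have "AE x in lborel. \<forall>n. x \<in> {-1 + 1/real (n+2)<..<1 - 1/real (n+2)} \<longrightarrow> ?d x = 0"
    unfolding AE_all_countable by blast
  then show ?thesis
  proof eventually_elim
    case (elim x)
    show ?case
    proof
      assume x: "x \<in> Ioo11"
      then have "min (1 + x) (1 - x) > 0" by auto
      then obtain n where n: "n > 0" "inverse (real n) < min (1 + x) (1 - x)" using ex_inverse_of_nat_less by blast
      have "1 / real (n + 2) \<le> inverse (real n)" using n by (simp add: field_simps)
      then have "x \<in> {-1 + 1/real (n+2)<..<1 - 1/real (n+2)}" using n by auto
      then show "g x = h x" using elim by fastforce
    qed
  qed
qed

section \<open>Classical solutions are weak solutions\<close>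

text \<open>Bridge from the Lebesgue integral over the open interval, used in the definitions, to
  the gauge integral over the closed one, where the fundamental theorem and the Leibniz rule are
  applied.\<close>

lemma LINT_Ioo11_continuous:
  fixes f :: "real \<Rightarrow> real"
  assumes "continuous_on {-1..1} f"
  shows "set_integrable lborel Ioo11 f" "(LINT x:Ioo11|lborel. f x) = integral {-1..1} f"
proof -
  show int: "set_integrable lborel Ioo11 f"
    by (rule set_integrable_subset[OF borel_integrable_atLeastAtMost'[OF assms]]) auto
  show "(LINT x:Ioo11|lborel. f x) = integral {-1..1} f"
    using set_borel_integral_eq_integral(2)[OF int] by (simp add: integral_open_interval_real)
qed

lemma L2_continuous:
  assumes "continuous_on {-1..1} f" shows "L2 f"
proof -
  have "set_integrable lborel Ioo11 f" by (rule LINT_Ioo11_continuous[OF assms])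
  then have "set_borel_measurable lborel Ioo11 f"
    unfolding set_integrable_def set_borel_measurable_def by auto
  then show ?thesis unfolding L2_def
    by (auto intro!: LINT_Ioo11_continuous(1) continuous_intros assms)
qed

lemma LINT_compact_support:
  fixes h :: "real \<Rightarrow> real"
  assumes "continuous_on {c..d} h" "\<And>x. x \<notin> {c..d} \<Longrightarrow> h x = 0"
  shows "(LINT x|lborel. h x) = integral {c..d} h"
proof -
  have "(LINT x|lborel. h x) = (LINT x:{c..d}|lborel. h x)"
    unfolding set_lebesgue_integral_def
    by (intro Bochner_Integration.integral_cong) (use assms(2) in \<open>auto simp: indicator_def\<close>)
  also have "\<dots> = integral {c..d} h"
    by (intro set_borel_integral_eq_integral borel_integrable_atLeastAtMost' assms)
  finally show ?thesis .
qed

lemma deriv_zero_outside: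
  assumes "\<And>x. x \<notin> {a..b} \<Longrightarrow> w x = (0::real)" "x \<notin> {a..b::real}"
  shows "deriv w x = 0"
proof -
  have "((\<lambda>_. 0) has_real_derivative 0) (at x)" by simp
  then have "(w has_real_derivative 0) (at x)"
    by (rule has_field_derivative_transform_within_open[of _ _ _ "- {a..b}"])
       (use assms in \<open>auto intro: open_Compl\<close>)
  then show ?thesis by (rule DERIV_imp_deriv)
qed

text \<open>There are no boundary terms: \<open>c < a\<close> and \<open>b < d\<close> place both
  ends of the interval outside the support of \<open>w\<close>.\<close>

lemma integral_by_parts_smooth:
  assumes w: "smooth_fun w" "\<And>x. x \<notin> {a..b} \<Longrightarrow> w x = 0" and "c < a" "b < d" "c \<le> d"
    and P: "continuous_on {c..d} P" "continuous_on {c..d} P'"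
      "\<And>x. x \<in> {c<..<d} \<Longrightarrow> (P has_real_derivative P' x) (at x)"
  shows "integral {c..d} (\<lambda>x. deriv w x * P x) = - integral {c..d} (\<lambda>x. w x * P' x)"
proof -
  note cw = smooth_fun_continuous[OF w(1)] smooth_fun_continuous[OF smooth_fun_deriv[OF w(1)]]
  have "((\<lambda>x. deriv w x * P x + w x * P' x) has_integral (w d * P d - w c * P c)) {c..d}"
  proof (rule fundamental_theorem_of_calculus_interior)
    show "continuous_on {c..d} (\<lambda>x. w x * P x)" by (intro continuous_intros cw P)
    fix x assume "x \<in> {c<..<d}"
    then show "((\<lambda>x. w x * P x) has_vector_derivative deriv w x * P x + w x * P' x) (at x)"
      unfolding has_real_derivative_iff_has_vector_derivative[symmetric]
      by (auto intro!: derivative_eq_intros smooth_fun_DERIV[OF w(1)] P(3))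
  qed (use assms in auto)
  moreover have "w c = 0" "w d = 0" using assms by auto
  ultimately have "integral {c..d} (\<lambda>x. deriv w x * P x + w x * P' x) = 0"
    by (simp add: integral_unique)
  moreover have "integral {c..d} (\<lambda>x. deriv w x * P x + w x * P' x)
     = integral {c..d} (\<lambda>x. deriv w x * P x) + integral {c..d} (\<lambda>x. w x * P' x)"
    by (intro Henstock_Kurzweil_Integration.integral_add integrable_continuous_real continuous_intros cw P)
  ultimately show ?thesis by linarith
qed

lemma weak_deriv_classical:
  assumes "continuous_on {-1..1} f" "continuous_on {-1..1} g"
    "\<And>x. x \<in> Ioo11 \<Longrightarrow> (f has_real_derivative g x) (at x)"
  shows "weak_deriv f g"
  unfolding weak_deriv_def
proof (intro conjI allI impI)
  show "loc_int f" "loc_int g" unfolding loc_int_def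
    using assms(1,2) by (auto intro!: borel_integrable_atLeastAtMost' elim!: continuous_on_subset)
  fix \<phi> assume "test_fun_x \<phi>"
  then obtain a b where ab: "-1 < a" "b < 1" "\<And>x. x \<notin> {a..b} \<Longrightarrow> \<phi> x = 0" and sm: "smooth_fun \<phi>"
    unfolding test_fun_x_def by blast
  note c = smooth_fun_continuous[OF sm] smooth_fun_continuous[OF smooth_fun_deriv[OF sm]]
  show "(LINT x:Ioo11|lborel. f x * deriv \<phi> x) = - (LINT x:Ioo11|lborel. g x * \<phi> x)"
    using integral_by_parts_smooth[OF sm ab(3) ab(1,2) _ assms]
    by (simp add: LINT_Ioo11_continuous continuous_on_mult assms c mult.commute)
qed

text \<open>Closed in space but open in time: traces can be read off at the endpoints, and
  conditions local in positive time involve only compact rectangles, while nothing is asked near t =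
  0.\<close>

abbreviation cont2 :: "(real \<Rightarrow> real \<Rightarrow> real) \<Rightarrow> bool" where
  "cont2 F \<equiv> continuous_on ({-1..1} \<times> {0<..}) (\<lambda>(x, t). F x t)"

lemma cont2_slice_x: "cont2 F \<Longrightarrow> t > 0 \<Longrightarrow> continuous_on {-1..1} (\<lambda>x. F x t)"
  by (rule continuous_on_compose2[of "{-1..1} \<times> {0<..}" "\<lambda>(x, t). F x t" _ "\<lambda>x. (x, t)", simplified])
     (auto intro!: continuous_intros)

lemma cont2_swap: "cont2 F \<Longrightarrow> continuous_on ({0<..} \<times> {-1..1}) (\<lambda>(t, x). F x t)"
  unfolding split_beta
  using continuous_on_compose2[of "{-1..1} \<times> {0<..}" "\<lambda>p. F (fst p) (snd p)" "{0<..} \<times> {-1..1}" "\<lambda>p. (snd p, fst p)"]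
  by (force intro!: continuous_intros)

lemma cont2_L2loc_L2:
  assumes "cont2 F" shows "L2loc_L2 F"
  unfolding L2loc_L2_def
proof (intro conjI allI impI)
  have "continuous_on (Ioo11 \<times> {0<..}) (\<lambda>(x, t). F x t)"
    by (rule continuous_on_subset[OF assms]) auto
  then show "set_borel_measurable (lborel \<Otimes>\<^sub>M lborel) (Ioo11 \<times> {0<..}) (\<lambda>(x, t). F x t)"
    unfolding lborel_prod set_borel_measurable_def
    using borel_measurable_continuous_on_indicator[of "Ioo11 \<times> {0<..}" "\<lambda>(x, t). F x t"]
    by (simp add: borel_Times)
  fix a b :: real assume a: "0 < a"
  have "continuous_on ({-1..1} \<times> {a..b}) (\<lambda>(x, t). F x t)"
    by (rule continuous_on_subset[OF assms]) (use a in auto)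
  then have c: "continuous_on ({-1..1} \<times> {a..b}) (\<lambda>(x, t). (F x t)\<^sup>2)"
    by (auto simp: split_beta intro: continuous_intros)
  have "set_integrable lborel ({-1..1} \<times> {a..b}) (\<lambda>(x, t). (F x t)\<^sup>2)"
    unfolding set_integrable_def
    by (rule borel_integrable_compact[OF compact_Times c]) auto
  then show "set_integrable (lborel \<Otimes>\<^sub>M lborel) (Ioo11 \<times> {a..b}) (\<lambda>(x, t). (F x t)\<^sup>2)"
    unfolding lborel_prod
    by (rule set_integrable_subset) (auto simp: borel_Times)
qed

lemma cont2_L2_dist_tendsto:
  assumes "cont2 F" "t > 0"
  shows "((\<lambda>s. L2_dist (\<lambda>x. F x s) (\<lambda>x. F x t)) \<longlongrightarrow> 0) (at t)"
proof -
  have "continuous_on ({0<..} \<times> cbox (-1) 1) (\<lambda>(s, x). (F x s - F x t)\<^sup>2)"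
    unfolding split_beta
    using cont2_swap[OF assms(1), unfolded split_beta]
    by (intro continuous_intros continuous_on_compose2[OF cont2_slice_x[OF assms], of _ snd]) auto
  then have "continuous_on {0<..} (\<lambda>s. integral (cbox (-1) 1) (\<lambda>x. (F x s - F x t)\<^sup>2))"
    by (rule integral_continuous_on_param)
  then have "isCont (\<lambda>s. integral (cbox (-1) 1) (\<lambda>x. (F x s - F x t)\<^sup>2)) t"
    using assms(2) by (simp add: continuous_on_eq_continuous_at)
  then have "((\<lambda>s. sqrt (integral {-1..1} (\<lambda>x. (F x s - F x t)\<^sup>2))) \<longlongrightarrow> sqrt 0) (at t)"
    unfolding isCont_def by (intro tendsto_real_sqrt) simp
  moreover have "\<forall>\<^sub>F s in at t. sqrt (integral {-1..1} (\<lambda>x. (F x s - F x t)\<^sup>2)) = L2_dist (\<lambda>x. F x s) (\<lambda>x. F x t)"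
    using eventually_at_in_open'[of "{0<..}" t] assms(2)
    by (auto elim!: eventually_mono simp: L2_dist_def LINT_Ioo11_continuous(2)
          continuous_on_power continuous_on_diff cont2_slice_x[OF assms(1)])
  ultimately show ?thesis by (simp add: tendsto_cong)
qed

lemma cont2_C_L2: "cont2 G \<Longrightarrow> C_L2 G"
  unfolding C_L2_def by (auto intro: cont2_L2_dist_tendsto L2_continuous cont2_slice_x)

lemma cont2_L2loc_H1rho:
  assumes "cont2 G" "cont2 Gx"
    "\<And>x t. x \<in> Ioo11 \<Longrightarrow> t > 0 \<Longrightarrow> ((\<lambda>x. G x t) has_real_derivative Gx x t) (at x)"
  shows "L2loc_H1rho G Gx"
  unfolding L2loc_H1rho_def
proof (intro conjI)
  have "cont2 (\<lambda>x t. sqrt (1 - x\<^sup>2) * Gx x t)"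
    using assms(2) by (auto simp: split_beta intro!: continuous_intros)
  then show "L2loc_L2 (\<lambda>x t. sqrt (1 - x\<^sup>2) * Gx x t)" by (rule cont2_L2loc_L2)
  show "AE t in lborel. t > 0 \<longrightarrow> weak_deriv (\<lambda>x. G x t) (\<lambda>x. Gx x t)"
    by (intro AE_I2 impI weak_deriv_classical cont2_slice_x assms) auto
qed (rule cont2_L2loc_L2[OF assms(1)])

text \<open>A pointwise limit of cut-offs to compact subintervals. It serves the weak derivative
  picked by choice, of which only local integrability is at hand.\<close>

lemma loc_int_measurable:
  assumes "loc_int g" shows "set_borel_measurable lborel Ioo11 g"
  unfolding set_borel_measurable_def
proof (rule borel_measurable_LIMSEQ_real)
  let ?I = "\<lambda>n. {-1 + 1/real (Suc n)..1 - 1/real (Suc n)}"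
  show "(\<lambda>x. indicator (?I n) x *\<^sub>R g x) \<in> borel_measurable lborel" for n
  proof -
    have "set_integrable lborel (?I n) g" using assms unfolding loc_int_def by auto
    then show ?thesis unfolding set_integrable_def by auto
  qed
  fix x :: real
  show "(\<lambda>n. indicator (?I n) x *\<^sub>R g x) \<longlonglongrightarrow> indicator Ioo11 x *\<^sub>R g x"
  proof (cases "x \<in> Ioo11")
    case True
    have "\<forall>\<^sub>F n in sequentially. 1/real (Suc n) < min (1 + x) (1 - x)"
      using True by (intro order_tendstoD(2)[OF LIMSEQ_Suc[OF lim_1_over_n]]) auto
    then have "\<forall>\<^sub>F n in sequentially. indicator (?I n) x *\<^sub>R g x = indicator Ioo11 x *\<^sub>R g x"
      by eventually_elim (use True in \<open>auto simp: indicator_def\<close>)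
    then show ?thesis by (rule tendsto_eventually)
  next
    case False
    have "1/real (Suc n) > 0" for n by simp
    then have "x \<notin> ?I n" for n using False by (smt (verit) atLeastAtMost_iff greaterThanLessThan_iff)
    then show ?thesis using False by simp
  qed
qed

lemma cont2_C_H1:
  assumes G: "cont2 G" "cont2 Gx"
    "\<And>x t. x \<in> Ioo11 \<Longrightarrow> t > 0 \<Longrightarrow> ((\<lambda>x. G x t) has_real_derivative Gx x t) (at x)"
  shows "C_H1 G"
  unfolding C_H1_def
proof (intro conjI allI impI)
  have wd: "weak_deriv (\<lambda>x. G x t) (\<lambda>x. Gx x t)" if "t > 0" for t
    using that by (intro weak_deriv_classical cont2_slice_x G) auto
  show "H1 (\<lambda>x. G x t)" if "t > 0" for t
    unfolding H1_def using wd[OF that] L2_continuous[OF cont2_slice_x[OF G(1) that]]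
      L2_continuous[OF cont2_slice_x[OF G(2) that]] by blast
  have wd': "weak_deriv (\<lambda>x. G x t) (wderiv (\<lambda>x. G x t))" if "t > 0" for t
    unfolding wderiv_def by (rule someI[of "weak_deriv (\<lambda>x. G x t)"]) (rule wd[OF that])
  \<comment> \<open>The chosen derivatives agree with \<open>Gx\<close> almost everywhere by
    uniqueness, and the distance does not see null sets. Equal integrals need both integrands
    measurable.\<close>
  have eq: "L2_dist (wderiv (\<lambda>x. G x s)) (wderiv (\<lambda>x. G x t)) = L2_dist (\<lambda>x. Gx x s) (\<lambda>x. Gx x t)"
    if s: "s > 0" and t: "t > 0" for s t
  proof -
    have "(LINT x:Ioo11|lborel. (wderiv (\<lambda>x. G x s) x - wderiv (\<lambda>x. G x t) x)\<^sup>2)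
        = (LINT x:Ioo11|lborel. (Gx x s - Gx x t)\<^sup>2)"
      unfolding set_lebesgue_integral_def
    proof (rule integral_cong_AE)
      have m: "(\<lambda>x. indicator Ioo11 x *\<^sub>R (g x - h x)\<^sup>2) \<in> borel_measurable lborel"
        if "loc_int g" "loc_int h" for g h
      proof -
        have [measurable]: "(\<lambda>x. indicator Ioo11 x *\<^sub>R g x) \<in> borel_measurable lborel"
          "(\<lambda>x. indicator Ioo11 x *\<^sub>R h x) \<in> borel_measurable lborel"
          using loc_int_measurable[OF that(1)] loc_int_measurable[OF that(2)]
          unfolding set_borel_measurable_def by auto
        have "(\<lambda>x. (indicator Ioo11 x *\<^sub>R g x - indicator Ioo11 x *\<^sub>R h x)\<^sup>2) \<in> borel_measurable lborel"
          by measurable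
        also have "(\<lambda>x. (indicator Ioo11 x *\<^sub>R g x - indicator Ioo11 x *\<^sub>R h x)\<^sup>2)
            = (\<lambda>x. indicator Ioo11 x *\<^sub>R (g x - h x)\<^sup>2)"
          by (auto simp: indicator_def fun_eq_iff)
        finally show ?thesis .
      qed
      show "(\<lambda>x. indicator Ioo11 x *\<^sub>R (wderiv (\<lambda>x. G x s) x - wderiv (\<lambda>x. G x t) x)\<^sup>2) \<in> borel_measurable lborel"
        "(\<lambda>x. indicator Ioo11 x *\<^sub>R (Gx x s - Gx x t)\<^sup>2) \<in> borel_measurable lborel"
        using wd[OF s] wd[OF t] wd'[OF s] wd'[OF t] unfolding weak_deriv_def by (intro m; blast)+
      show "AE x in lborel. indicator Ioo11 x *\<^sub>R (wderiv (\<lambda>x. G x s) x - wderiv (\<lambda>x. G x t) x)\<^sup>2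
          = indicator Ioo11 x *\<^sub>R (Gx x s - Gx x t)\<^sup>2"
        using weak_deriv_unique[OF wd'[OF s] wd[OF s]] weak_deriv_unique[OF wd'[OF t] wd[OF t]]
        by eventually_elim (auto simp: indicator_def)
    qed
    then show ?thesis by (simp add: L2_dist_def)
  qed
  fix t :: real assume t: "t > 0"
  have "((\<lambda>s. sqrt ((L2_dist (\<lambda>x. G x s) (\<lambda>x. G x t))\<^sup>2 + (L2_dist (\<lambda>x. Gx x s) (\<lambda>x. Gx x t))\<^sup>2))
      \<longlongrightarrow> sqrt (0\<^sup>2 + 0\<^sup>2)) (at t)"
    by (intro tendsto_intros cont2_L2_dist_tendsto G t)
  moreover have "\<forall>\<^sub>F s in at t. sqrt ((L2_dist (\<lambda>x. G x s) (\<lambda>x. G x t))\<^sup>2 + (L2_dist (\<lambda>x. Gx x s) (\<lambda>x. Gx x t))\<^sup>2)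
      = H1_dist (\<lambda>x. G x s) (\<lambda>x. G x t)"
    using eventually_at_in_open'[of "{0<..}" t] t
    by (auto elim!: eventually_mono simp: H1_dist_def eq)
  ultimately show "((\<lambda>s. H1_dist (\<lambda>x. G x s) (\<lambda>x. G x t)) \<longlongrightarrow> 0) (at t)"
    by (simp add: tendsto_cong)
qed

lemma pair_cont2:
  assumes "cont2 G" "smooth_fun v" "t > 0"
  shows "pair G v t = integral {-1..1} (\<lambda>x. G x t * v x)"
  unfolding pair_def
  by (intro LINT_Ioo11_continuous continuous_intros cont2_slice_x smooth_fun_continuous assms)

text \<open>The pairing with \<open>v\<close> is differentiated under the integral sign, then
  integrated by parts against \<open>w\<close> in time.\<close>

lemma cont2_weak_dt:
  assumes G: "cont2 G" "cont2 Gt"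
    "\<And>x t. x \<in> {-1..1} \<Longrightarrow> t > 0 \<Longrightarrow> ((\<lambda>t. G x t) has_real_derivative Gt x t) (at t)"
    and v: "test_fun_x v" and w: "test_fun_t w"
  shows "(LINT t|lborel. deriv w t * pair G v t) = - (LINT t|lborel. w t * pair Gt v t)"
proof -
  have sv: "smooth_fun v" using v by (simp add: test_fun_x_def)
  note cv = smooth_fun_continuous[OF sv]
  obtain a b where ab: "0 < a" "\<And>t. t \<notin> {a..b} \<Longrightarrow> w t = 0" and sw: "smooth_fun w"
    using w unfolding test_fun_t_def by blast
  note cw = smooth_fun_continuous[OF sw] smooth_fun_continuous[OF smooth_fun_deriv[OF sw]]
  let ?I = "\<lambda>F t. integral (cbox (-1) 1) (\<lambda>x. F x t * v x)"
  have cc: "continuous_on ({0<..} \<times> cbox (-1) 1) (\<lambda>(t, x). F x t * v x)" if "cont2 F" for F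
    using cont2_swap[OF that] unfolding split_beta
    by (intro continuous_intros continuous_on_compose2[OF cv[of UNIV]]) auto
  have cI: "continuous_on {0<..} (?I F)" if "cont2 F" for F
    by (intro integral_continuous_on_param cc that)
  have dI: "(?I G has_real_derivative ?I Gt t) (at t)" if "t > 0" for t
  proof -
    have "(?I G has_real_derivative ?I Gt t) (at t within {0<..})"
    proof (rule leibniz_rule_field_derivative)
      show "continuous_on ({0<..} \<times> cbox (-1) 1) (\<lambda>(t, x). Gt x t * v x)" by (rule cc[OF G(2)])
      show "(\<lambda>x. G x t * v x) integrable_on cbox (-1) 1" if "t \<in> {0<..}" for t
        using that by (intro integrable_continuous continuous_intros cv) (auto intro: cont2_slice_x[OF G(1)])
      fix t x :: real assume "t \<in> {0<..}" "x \<in> cbox (-1) 1"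
      then show "((\<lambda>t. G x t * v x) has_real_derivative Gt x t * v x) (at t within {0<..})"
        by (intro DERIV_cmult_right has_field_derivative_at_within[OF G(3)]) auto
    qed (use that in auto)
    then show ?thesis using that by (simp add: at_within_open[of t "{0<..}"])
  qed
  \<comment> \<open>The interval surrounds the support of \<open>w\<close> strictly and stays in t >
    0. The maximum covers the case \<open>b < a\<close>, where \<open>w\<close> is identically
    0.\<close>
  define c d where "c = a / 2" and "d = max a b + 1"
  have cd: "0 < c" "c < a" "b < d" "c \<le> d" using ab(1) by (auto simp: c_def d_def)
  have sub: "{c..d} \<subseteq> {0<..}" using cd by auto
  have pI: "pair F v t = ?I F t" if "cont2 F" "t \<in> {c..d}" for F t
    using pair_cont2[OF that(1) sv, of t] that(2) cd by simp
  have pc: "continuous_on {c..d} (pair F v)" if "cont2 F" for F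
    using continuous_on_subset[OF cI[OF that] sub] 
    by (rule continuous_on_cong[THEN iffD1, rotated 2]) (use pI[OF that] in auto)
  have 1: "(LINT t|lborel. deriv w t * pair G v t) = integral {c..d} (\<lambda>t. deriv w t * pair G v t)"
    using cd by (intro LINT_compact_support continuous_intros pc cw G) (auto intro!: deriv_zero_outside[OF ab(2)])
  have 2: "(LINT t|lborel. w t * pair Gt v t) = integral {c..d} (\<lambda>t. w t * pair Gt v t)"
    using cd by (intro LINT_compact_support continuous_intros pc cw G) (auto intro!: ab(2))
  have "integral {c..d} (\<lambda>t. deriv w t * pair G v t) = integral {c..d} (\<lambda>t. deriv w t * ?I G t)"
    by (intro integral_cong) (simp add: pI G)
  also have "\<dots> = - integral {c..d} (\<lambda>t. w t * ?I Gt t)"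
    using cd sub
    by (intro integral_by_parts_smooth[OF sw ab(2)] continuous_on_subset[OF cI[OF G(1)]] continuous_on_subset[OF cI[OF G(2)]] dI) auto
  also have "integral {c..d} (\<lambda>t. w t * ?I Gt t) = integral {c..d} (\<lambda>t. w t * pair Gt v t)"
    by (intro integral_cong) (simp add: pI G)
  finally show ?thesis using 1 2 by simp
qed

lemma trace_continuous:
  assumes "continuous_on {-1..1} f"
  shows "trace_at_1 f (f 1)" "trace_at_m1 f (f (-1))"
proof -
  have c: "continuous_on Ioo11 f" by (rule continuous_on_subset[OF assms]) auto
  have "(f \<longlongrightarrow> f 1) (at 1 within {-1..1})" "(f \<longlongrightarrow> f (-1)) (at (-1) within {-1..1})"
    using assms by (auto simp: continuous_on)
  then have "(f \<longlongrightarrow> f 1) (at_left 1)" "(f \<longlongrightarrow> f (-1)) (at_right (-1))"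
    by (simp_all add: at_within_Icc_at_left at_within_Icc_at_right)
  then show "trace_at_1 f (f 1)" "trace_at_m1 f (f (-1))"
    unfolding trace_at_1_def trace_at_m1_def using c by auto
qed

text \<open>This separates the analysis of the series from the weak notions: the series has only to
  solve the equation classically for t > 0, continuously up to the spatial boundary, and to attain
  its initial value in L^2.\<close>

lemma classical_solution_weak:
  assumes G: "cont2 G" "cont2 Gx" "cont2 Gxx" "cont2 Gt"
    and dx: "\<And>x t. x \<in> Ioo11 \<Longrightarrow> t > 0 \<Longrightarrow> ((\<lambda>x. G x t) has_real_derivative Gx x t) (at x)"
    and dxx: "\<And>x t. x \<in> Ioo11 \<Longrightarrow> t > 0 \<Longrightarrow> ((\<lambda>x. Gx x t) has_real_derivative Gxx x t) (at x)"
    and dt: "\<And>x t. x \<in> {-1..1} \<Longrightarrow> t > 0 \<Longrightarrow> ((\<lambda>t. G x t) has_real_derivative Gt x t) (at t)"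
    and pde: "\<And>x t. x \<in> {-1..1} \<Longrightarrow> t > 0 \<Longrightarrow> Gt x t = lam / 2 * (1 - x\<^sup>2) * Gxx x t"
    and bd: "\<And>t. t > 0 \<Longrightarrow> G 1 t = 1" "\<And>t. t > 0 \<Longrightarrow> G (-1) t = p"
    and init: "((\<lambda>t. L2_dist (\<lambda>x. G x t) G0) \<longlongrightarrow> 0) (at_right 0)"
  shows "weak_solution lam G0 p G Gx \<and> L2loc_H1rho Gx Gxx \<and> C_H1 G \<and> dt_L2loc_L2 G"
proof -
  have wpde: "weak_pde lam G Gx"
    unfolding weak_pde_def
  proof (intro allI impI)
    fix v w assume v: "test_fun_x v" and w: "test_fun_t w"
    obtain a b where ab: "-1 < a" "b < 1" "\<And>x. x \<notin> {a..b} \<Longrightarrow> v x = 0" and sv: "smooth_fun v"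
      using v unfolding test_fun_x_def by blast
    note cv = smooth_fun_continuous[OF sv] smooth_fun_continuous[OF smooth_fun_deriv[OF sv]]
    let ?J = "\<lambda>t. LINT x:Ioo11|lborel. Gx x t * ((1 - x\<^sup>2) * deriv v x - 2 * x * v x)"
    \<comment> \<open>Spatial integration by parts at a fixed time. The weight 1 - x^2 removes the
      boundary terms.\<close>
    have key: "pair Gt v t = - (lam / 2 * ?J t)" if t: "t > 0" for t
    proof -
      note cs = cont2_slice_x[OF G(2) t] cont2_slice_x[OF G(3) t]
      have "((\<lambda>x. Gx x t * ((1 - x\<^sup>2) * deriv v x - 2 * x * v x) + Gxx x t * ((1 - x\<^sup>2) * v x)) has_integral
          (Gx 1 t * ((1 - 1\<^sup>2) * v 1) - Gx (-1) t * ((1 - (-1)\<^sup>2) * v (-1)))) {-1..1}"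
      proof (rule fundamental_theorem_of_calculus_interior)
        show "continuous_on {-1..1} (\<lambda>x. Gx x t * ((1 - x\<^sup>2) * v x))"
          by (intro continuous_intros cs cv)
        fix x :: real assume "x \<in> Ioo11"
        then show "((\<lambda>x. Gx x t * ((1 - x\<^sup>2) * v x)) has_vector_derivative
            Gx x t * ((1 - x\<^sup>2) * deriv v x - 2 * x * v x) + Gxx x t * ((1 - x\<^sup>2) * v x)) (at x)"
          unfolding has_real_derivative_iff_has_vector_derivative[symmetric]
          by (auto intro!: derivative_eq_intros dxx t smooth_fun_DERIV[OF sv] simp: algebra_simps)
      qed simp
      then have z: "integral {-1..1} (\<lambda>x. Gx x t * ((1 - x\<^sup>2) * deriv v x - 2 * x * v x) + Gxx x t * ((1 - x\<^sup>2) * v x)) = 0"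
        by (simp add: integral_unique)
      have s: "integral {-1..1} (\<lambda>x. Gx x t * ((1 - x\<^sup>2) * deriv v x - 2 * x * v x) + Gxx x t * ((1 - x\<^sup>2) * v x))
         = integral {-1..1} (\<lambda>x. Gx x t * ((1 - x\<^sup>2) * deriv v x - 2 * x * v x)) + integral {-1..1} (\<lambda>x. Gxx x t * ((1 - x\<^sup>2) * v x))"
        by (intro Henstock_Kurzweil_Integration.integral_add integrable_continuous_real continuous_intros cs cv)
      have "pair Gt v t = integral {-1..1} (\<lambda>x. Gt x t * v x)" by (rule pair_cont2[OF G(4) sv t])
      also have "\<dots> = integral {-1..1} (\<lambda>x. lam / 2 * (Gxx x t * ((1 - x\<^sup>2) * v x)))"
        using t by (intro integral_cong) (simp add: pde)
      also have "\<dots> = lam / 2 * integral {-1..1} (\<lambda>x. Gxx x t * ((1 - x\<^sup>2) * v x))"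
        by (rule integral_mult_right)
      also have "\<dots> = - (lam / 2 * integral {-1..1} (\<lambda>x. Gx x t * ((1 - x\<^sup>2) * deriv v x - 2 * x * v x)))"
      proof -
        have "integral {-1..1} (\<lambda>x. Gxx x t * ((1 - x\<^sup>2) * v x))
            = - integral {-1..1} (\<lambda>x. Gx x t * ((1 - x\<^sup>2) * deriv v x - 2 * x * v x))"
          using z s by linarith
        then show ?thesis by simp
      qed
      also have "integral {-1..1} (\<lambda>x. Gx x t * ((1 - x\<^sup>2) * deriv v x - 2 * x * v x)) = ?J t"
        by (intro LINT_Ioo11_continuous(2)[symmetric] continuous_intros cs cv)
      finally show ?thesis .
    qed
    \<comment> \<open>No information on \<open>G\<close> is available for t \<le> 0, but there both
      integrands vanish with \<open>w\<close>.\<close>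
    have w0: "w t = 0" if "t \<le> 0" for t
      using w that unfolding test_fun_t_def by force
    have "(LINT t|lborel. deriv w t * pair G v t) = - (LINT t|lborel. w t * pair Gt v t)"
      by (rule cont2_weak_dt[OF G(1,4) dt v w])
    also have "(LINT t|lborel. w t * pair Gt v t) = (LINT t|lborel. - (lam / 2) * (w t * ?J t))"
    proof (rule Bochner_Integration.integral_cong)
      show "w t * pair Gt v t = - (lam / 2) * (w t * ?J t)" for t
        by (cases "t > 0") (simp_all add: key w0)
    qed simp
    finally show "(LINT t|lborel. deriv w t * pair G v t) = lam / 2 * (LINT t|lborel. w t * ?J t)"
      by (simp only: integral_mult_right_zero)
  qed
  have Gt: "L2loc_L2 Gt" by (rule cont2_L2loc_L2[OF G(4)])
  have dt2: "dt_L2loc_L2 G"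
    unfolding dt_L2loc_L2_def using Gt cont2_weak_dt[OF G(1,4) dt] by blast
  have "dt_L2loc_Hm1 G"
    unfolding dt_L2loc_Hm1_def
  proof (rule exI[of _ Gt], rule exI[of _ "\<lambda>x t. 0"], intro conjI allI impI)
    show "L2loc_L2 (\<lambda>x t. 0)" by (rule cont2_L2loc_L2) (simp add: split_beta)
    show "(LINT t|lborel. deriv w t * pair G v t) =
        - (LINT t|lborel. w t * (pair Gt v t - pair (\<lambda>x t. 0) (deriv v) t))"
      if "test_fun_x v" "test_fun_t w" for v w
      using cont2_weak_dt[OF G(1,4) dt that] by (simp add: pair_def[of "\<lambda>x t. 0"])
  qed (rule Gt)
  moreover have "AE t in lborel. t > 0 \<longrightarrow> trace_at_1 (\<lambda>x. G x t) 1 \<and> trace_at_m1 (\<lambda>x. G x t) p"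
    using trace_continuous[OF cont2_slice_x[OF G(1)]] bd by (intro AE_I2) auto
  ultimately have "weak_solution lam G0 p G Gx"
    unfolding weak_solution_def
    using cont2_C_L2[OF G(1)] cont2_L2loc_H1rho[OF G(1,2) dx] wpde init by blast
  then show ?thesis using cont2_L2loc_H1rho[OF G(2,3) dxx] cont2_C_H1[OF G(1,2) dx] dt2 by blast
qed

section \<open>Series of decaying modes\<close>

definition decay_rate :: "real \<Rightarrow> nat \<Rightarrow> real" where
  "decay_rate lam n = lam / 2 * eigval n"

definition mode_series :: "real \<Rightarrow> (nat \<Rightarrow> real \<Rightarrow> real) \<Rightarrow> real \<Rightarrow> real \<Rightarrow> real" where
  "mode_series lam f x t = (\<Sum>n. exp (- decay_rate lam n * t) * f n x)"

text \<open>The growth class for the series: it is closed under products, contains all the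
  ingredients of the modes, and is summed by the time factors at every t > 0.\<close>

definition exp_bounded :: "(nat \<Rightarrow> real \<Rightarrow> real) \<Rightarrow> bool" where
  "exp_bounded f \<longleftrightarrow> (\<exists>A C. 0 \<le> A \<and> 0 \<le> C \<and> (\<forall>n. \<forall>x\<in>{-1..1}. \<bar>f n x\<bar> \<le> A * C^n))"

lemma exp_bounded_mult:
  assumes "exp_bounded f" "exp_bounded g" shows "exp_bounded (\<lambda>n x. f n x * g n x)"
proof -
  obtain A C where f: "0 \<le> A" "0 \<le> C" "\<And>n x. x \<in> {-1..1} \<Longrightarrow> \<bar>f n x\<bar> \<le> A * C^n"
    using assms(1) unfolding exp_bounded_def by blast
  obtain B D where g: "0 \<le> B" "0 \<le> D" "\<And>n x. x \<in> {-1..1} \<Longrightarrow> \<bar>g n x\<bar> \<le> B * D^n"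
    using assms(2) unfolding exp_bounded_def by blast
  have "\<bar>f n x * g n x\<bar> \<le> (A * B) * (C * D)^n" if "x \<in> {-1..1}" for n x
  proof -
    have "\<bar>f n x\<bar> * \<bar>g n x\<bar> \<le> (A * C^n) * (B * D^n)"
      using f g that by (intro mult_mono) auto
    then show ?thesis by (simp add: abs_mult power_mult_distrib mult_ac)
  qed
  then show ?thesis unfolding exp_bounded_def using f g by (intro exI[of _ "A * B"] exI[of _ "C * D"]) auto
qed

lemma eigval_le: "eigval n \<le> 2 * 4^n"
proof -
  have "eigval n \<le> 2^n * (2 * 2^n)"
    unfolding eigval_def using nat_le_pow2[of n] one_le_power[of "2::real" n] by (intro mult_mono) auto
  also have "\<dots> = 2 * 4^n" by (simp flip: power_mult_distrib)
  finally show ?thesis .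
qed

lemma exp_bounded_eigval: "exp_bounded (\<lambda>n x. eigval n)"
  unfolding exp_bounded_def using eigval_le eigval_pos
  by (intro exI[of _ 2] exI[of _ 4]) (simp add: less_imp_le)

lemma exp_bounded_const: "exp_bounded (\<lambda>n x. c)"
  unfolding exp_bounded_def by (intro exI[of _ "\<bar>c\<bar>"] exI[of _ 1]) auto

lemma exp_bounded_phi: "exp_bounded (\<lambda>n. poly (phi n))"
  unfolding exp_bounded_def using phi_bound(1) by (intro exI[of _ 4] exI[of _ 32]) auto

lemma exp_bounded_pderiv_phi: "exp_bounded (\<lambda>n. poly (pderiv (phi n)))"
  unfolding exp_bounded_def using phi_bound(2) by (intro exI[of _ 12] exI[of _ 32]) auto

lemma exp_bounded_psi: "exp_bounded (\<lambda>n. poly (psi n))"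
  unfolding exp_bounded_def using psi_bound(1) by (intro exI[of _ 4] exI[of _ 32]) auto

lemma exp_bounded_inverse_psi_norm: "exp_bounded (\<lambda>n x. 1 / psi_norm n)"
  unfolding exp_bounded_def using inverse_psi_norm_le psi_norm_pos
  by (intro exI[of _ 1024] exI[of _ 1024]) (simp add: less_imp_le)

text \<open>Ratio test: consecutive decay rates differ by lam (n + 2), so the ratio of terms is C
  exp(- lam t (n + 2)), which tends to 0.\<close>

lemma summable_majorant:
  assumes "lam > 0" "t > 0" "A \<ge> 0" "C \<ge> 0"
  shows "summable (\<lambda>n. exp (- decay_rate lam n * t) * (A * C^n))"
proof -
  \<comment> \<open>From this index on, exp y \<ge> y already makes the ratio at most 1/2.\<close>
  obtain N :: nat where N: "2 * C / (lam * t) < real N" using reals_Archimedean2 by blast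
  show ?thesis
  proof (rule summable_ratio_test[of "1/2" N])
    fix n assume n: "N \<le> n"
    have lt: "lam * t > 0" using assms by simp
    have e: "exp (- decay_rate lam (Suc n) * t) = exp (- decay_rate lam n * t) * exp (- (lam * t * (real n + 2)))"
      by (simp add: decay_rate_def eigval_def algebra_simps flip: exp_add)
    have "2 * C < lam * t * real N" using N lt by (simp add: field_simps)
    also have "\<dots> \<le> lam * t * (real n + 2)" using n lt by (intro mult_left_mono) auto
    also have "\<dots> \<le> exp (lam * t * (real n + 2))" using exp_ge_add_one_self[of "lam * t * (real n + 2)"] by linarith
    finally have "C * exp (- (lam * t * (real n + 2))) \<le> 1/2"
      unfolding exp_minus by (simp add: field_simps del: mult_exp_exp)
    then have "exp (- decay_rate lam n * t) * (A * C^n) * (C * exp (- (lam * t * (real n + 2))))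
        \<le> exp (- decay_rate lam n * t) * (A * C^n) * (1/2)"
      using assms by (intro mult_left_mono) auto
    then show "norm (exp (- decay_rate lam (Suc n) * t) * (A * C ^ Suc n)) \<le> 1/2 * norm (exp (- decay_rate lam n * t) * (A * C^n))"
      unfolding e using assms by (simp add: abs_mult mult_ac)
  qed simp
qed

lemma decay_rate_pos: "lam > 0 \<Longrightarrow> decay_rate lam n > 0"
  by (simp add: decay_rate_def eigval_pos)

lemma mode_series_term_bound:
  assumes "lam > 0" "\<bar>y\<bar> \<le> B" "d \<le> t"
  shows "\<bar>exp (- decay_rate lam n * t) * y\<bar> \<le> exp (- decay_rate lam n * d) * B"
proof -
  have "exp (- decay_rate lam n * t) \<le> exp (- decay_rate lam n * d)"
    using assms decay_rate_pos[OF assms(1), of n] by (simp add: mult_left_mono)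
  then show ?thesis unfolding abs_mult using assms(2) by (intro mult_mono) auto
qed

lemma mode_series_summable:
  assumes "lam > 0" "t > 0" "exp_bounded f" "x \<in> {-1..1}"
  shows "summable (\<lambda>n. exp (- decay_rate lam n * t) * f n x)"
proof -
  obtain A C where f: "0 \<le> A" "0 \<le> C" "\<And>n x. x \<in> {-1..1} \<Longrightarrow> \<bar>f n x\<bar> \<le> A * C^n"
    using assms(3) unfolding exp_bounded_def by blast
  show ?thesis
    by (rule summable_comparison_test'[OF summable_majorant[OF assms(1,2) f(1,2)], of 0])
       (unfold real_norm_def, rule mode_series_term_bound[OF assms(1) f(3)[OF assms(4)] order_refl])
qed

text \<open>The time factors decrease in t, so the majorant at t = d serves for the whole half-strip
  in the Weierstrass test.\<close>

lemma mode_series_uniform_limit: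
  assumes "lam > 0" "d > 0" "exp_bounded f"
  shows "uniform_limit ({-1..1} \<times> {d..}) (\<lambda>n p. \<Sum>i<n. exp (- decay_rate lam i * snd p) * f i (fst p))
     (\<lambda>p. mode_series lam f (fst p) (snd p)) sequentially"
proof -
  obtain A C where f: "0 \<le> A" "0 \<le> C" "\<And>n x. x \<in> {-1..1} \<Longrightarrow> \<bar>f n x\<bar> \<le> A * C^n"
    using assms(3) unfolding exp_bounded_def by blast
  show ?thesis unfolding mode_series_def
  proof (rule Weierstrass_m_test[OF _ summable_majorant[OF assms(1,2) f(1,2)]])
    fix n p assume "p \<in> {-1..1::real} \<times> {d..}"
    then show "norm (exp (- decay_rate lam n * snd p) * f n (fst p)) \<le> exp (- decay_rate lam n * d) * (A * C^n)"
      unfolding real_norm_def by (intro mode_series_term_bound assms f) auto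
  qed
qed

lemma mode_series_cont2:
  assumes "lam > 0" "exp_bounded f" "\<And>n. continuous_on {-1..1} (f n)"
  shows "cont2 (mode_series lam f)"
proof -
  have c: "continuous_on ({-1..1} \<times> {d..}) (\<lambda>p. mode_series lam f (fst p) (snd p))" if "d > 0" for d
  proof (rule uniform_limit_theorem[OF _ mode_series_uniform_limit[OF assms(1) that assms(2)]])
    show "\<forall>\<^sub>F n in sequentially. continuous_on ({-1..1} \<times> {d..})
        (\<lambda>p. \<Sum>i<n. exp (- decay_rate lam i * snd p) * f i (fst p))"
      by (intro always_eventually allI continuous_intros continuous_on_compose2[OF assms(3)]) auto
  qed simp
  show ?thesis
    unfolding continuous_on_eq_continuous_within
  proof
    fix p :: "real \<times> real" assume p: "p \<in> {-1..1} \<times> {0<..}"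
    \<comment> \<open>Continuity is local: near \<open>p\<close> the domain coincides with a
      half-strip on which convergence is uniform.\<close>
    define d where "d = snd p / 2"
    have d: "d > 0" "snd p > d" using p by (auto simp: d_def)
    have "continuous (at p within {-1..1} \<times> {d..}) (\<lambda>p. mode_series lam f (fst p) (snd p))"
      using c[OF d(1)] p d unfolding continuous_on_eq_continuous_within by (cases p) auto
    also have "at p within {-1..1} \<times> {d..} = at p within {-1..1} \<times> {0<..}"
      by (rule at_within_nhd[of p "UNIV \<times> {d<..}"]) (use p d in \<open>auto simp: open_Times mem_Times_iff\<close>)
    finally show "continuous (at p within {-1..1} \<times> {0<..}) (\<lambda>(x, t). mode_series lam f x t)"
      by (simp add: case_prod_unfold)
  qed
qed

lemma mode_series_DERIV_x:
  assumes "lam > 0" "exp_bounded f" "exp_bounded f'" "x \<in> Ioo11" "t > 0"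
    and d: "\<And>n x. (f n has_real_derivative f' n x) (at x)"
  shows "((\<lambda>x. mode_series lam f x t) has_real_derivative mode_series lam f' x t) (at x)"
  unfolding mode_series_def
proof (rule has_field_derivative_series'(2)[where S = "{-1..1}" and ?x0.0 = 0
      and f = "\<lambda>n x. exp (- decay_rate lam n * t) * f n x" and f' = "\<lambda>n x. exp (- decay_rate lam n * t) * f' n x"])
  show "((\<lambda>x. exp (- decay_rate lam n * t) * f n x) has_real_derivative exp (- decay_rate lam n * t) * f' n x) (at x within {-1..1})" for n x
    by (intro DERIV_cmult has_field_derivative_at_within[OF d])
  have "uniform_limit {-1..1} (\<lambda>n x. \<Sum>i<n. exp (- decay_rate lam i * t) * f' i x) (\<lambda>x. mode_series lam f' x t) sequentially"
    using uniform_limit_compose'[OF mode_series_uniform_limit[OF assms(1,5,3)], of "\<lambda>x. (x, t)" "{-1..1}"] by auto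
  then show "uniformly_convergent_on {-1..1} (\<lambda>n x. \<Sum>i<n. exp (- decay_rate lam i * t) * f' i x)"
    unfolding uniformly_convergent_on_def by blast
  show "summable (\<lambda>n. exp (- decay_rate lam n * t) * f n 0)" by (rule mode_series_summable) (use assms in auto)
qed (use assms in auto)

lemma mode_series_DERIV_t:
  assumes "lam > 0" "exp_bounded f" "x \<in> {-1..1}" "t > 0"
  shows "((\<lambda>t. mode_series lam f x t) has_real_derivative mode_series lam (\<lambda>n x. - decay_rate lam n * f n x) x t) (at t)"
  unfolding mode_series_def
\<comment> \<open>The half-line from t/2 has t in its interior and keeps a positive distance from 0,
  where uniform convergence may fail.\<close>
proof (rule has_field_derivative_series'(2)[where S = "{t/2..}" and ?x0.0 = t
      and f = "\<lambda>n t. exp (- decay_rate lam n * t) * f n x"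
      and f' = "\<lambda>n t. exp (- decay_rate lam n * t) * (- decay_rate lam n * f n x)"])
  show "((\<lambda>t. exp (- decay_rate lam n * t) * f n x) has_real_derivative exp (- decay_rate lam n * t) * (- decay_rate lam n * f n x)) (at t within {t'..})" for n t t'
    by (auto intro!: derivative_eq_intros)
  have e: "exp_bounded (\<lambda>n x. - decay_rate lam n * f n x)"
    using exp_bounded_mult[OF exp_bounded_mult[OF exp_bounded_const exp_bounded_eigval] assms(2), of "- lam / 2"]
    by (simp add: decay_rate_def)
  have "uniform_limit {t/2..} (\<lambda>n s. \<Sum>i<n. exp (- decay_rate lam i * s) * (- decay_rate lam i * f i x))
      (\<lambda>s. mode_series lam (\<lambda>n x. - decay_rate lam n * f n x) x s) sequentially"
    using uniform_limit_compose'[OF mode_series_uniform_limit[OF assms(1) _ e, of "t/2"], of "\<lambda>s. (x, s)" "{t/2..}"] assms by auto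
  then show "uniformly_convergent_on {t/2..} (\<lambda>n s. \<Sum>i<n. exp (- decay_rate lam i * s) * (- decay_rate lam i * f i x))"
    unfolding uniformly_convergent_on_def by blast
  show "summable (\<lambda>n. exp (- decay_rate lam n * t) * f n x)" by (rule mode_series_summable) (use assms in auto)
qed (use assms in auto)

section \<open>Density in the unweighted space\<close>

definition sq_norm :: "(real \<Rightarrow> real) \<Rightarrow> real" where
  "sq_norm f = (LINT x:Ioo11|lborel. (f x)\<^sup>2)"

lemma L2D_measurable: "L2 f \<Longrightarrow> (\<lambda>x. indicator Ioo11 x * f x) \<in> borel_measurable borel"
  by (simp add: L2_def set_borel_measurable_def)

lemma L2_prod:
  assumes "L2 f" "L2 g" shows "set_integrable lborel Ioo11 (\<lambda>x. f x * g x)"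
  unfolding set_integrable_def
proof (rule Bochner_Integration.integrable_bound)
  show "integrable lborel (\<lambda>x. indicator Ioo11 x *\<^sub>R (f x)\<^sup>2 + indicator Ioo11 x *\<^sub>R (g x)\<^sup>2)"
    using assms unfolding L2_def set_integrable_def by auto
  have "(\<lambda>x. (indicator Ioo11 x * f x) * (indicator Ioo11 x * g x)) \<in> borel_measurable borel"
    using L2D_measurable[OF assms(1)] L2D_measurable[OF assms(2)] by measurable
  also have "(\<lambda>x. (indicator Ioo11 x * f x) * (indicator Ioo11 x * g x)) = (\<lambda>x. indicator Ioo11 x *\<^sub>R (f x * g x))"
    by (auto simp: indicator_def fun_eq_iff)
  finally show "(\<lambda>x. indicator Ioo11 x *\<^sub>R (f x * g x)) \<in> borel_measurable lborel" by simp
  have "\<bar>a * b\<bar> \<le> a\<^sup>2 + b\<^sup>2" for a b :: real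
    using sum_squares_bound[of "\<bar>a\<bar>" "\<bar>b\<bar>"] mult_nonneg_nonneg[of "\<bar>a\<bar>" "\<bar>b\<bar>"]
    unfolding abs_mult power2_abs by linarith
  then show "AE x in lborel. norm (indicator Ioo11 x *\<^sub>R (f x * g x)) \<le> norm (indicator Ioo11 x *\<^sub>R (f x)\<^sup>2 + indicator Ioo11 x *\<^sub>R (g x)\<^sup>2)"
    by (intro AE_I2) (auto simp: indicator_def)
qed

lemma L2_add: "L2 f \<Longrightarrow> L2 g \<Longrightarrow> L2 (\<lambda>x. f x + g x)"
proof -
  assume f: "L2 f" and g: "L2 g"
  have "set_integrable lborel Ioo11 (\<lambda>x. (f x)\<^sup>2 + 2 * (f x * g x) + (g x)\<^sup>2)"
    using f g L2_prod[OF f g] by (intro set_integral_add) (auto simp: L2_def)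
  moreover have "set_borel_measurable lborel Ioo11 (\<lambda>x. f x + g x)"
    using L2D_measurable[OF f] L2D_measurable[OF g]
    by (simp add: set_borel_measurable_def distrib_left)
  ultimately show ?thesis by (simp add: L2_def power2_sum algebra_simps)
qed

lemma L2_cmult: "L2 f \<Longrightarrow> L2 (\<lambda>x. c * f x)"
proof -
  assume f: "L2 f"
  have "(\<lambda>x. c * (indicator Ioo11 x * f x)) \<in> borel_measurable borel"
    using L2D_measurable[OF f] by measurable
  then have "set_borel_measurable lborel Ioo11 (\<lambda>x. c * f x)"
    by (simp add: set_borel_measurable_def mult.left_commute)
  then show ?thesis using f by (simp add: L2_def power_mult_distrib)
qed

lemma L2_diff: "L2 f \<Longrightarrow> L2 g \<Longrightarrow> L2 (\<lambda>x. f x - g x)"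
  using L2_add[of f "\<lambda>x. (-1) * g x"] L2_cmult[of g "-1"] by simp

lemma L2_integrable: "L2 f \<Longrightarrow> set_integrable lborel Ioo11 f"
  using L2_prod[of f "\<lambda>_. 1"] L2_continuous[OF continuous_on_const[of _ 1]] by simp

lemma L2_abs: "L2 f \<Longrightarrow> L2 (\<lambda>x. \<bar>f x\<bar>)"
proof -
  assume f: "L2 f"
  have "(\<lambda>x. \<bar>indicator Ioo11 x * f x\<bar>) \<in> borel_measurable borel"
    using L2D_measurable[OF f] by measurable
  also have "(\<lambda>x. \<bar>indicator Ioo11 x * f x\<bar>) = (\<lambda>x. indicator Ioo11 x * \<bar>f x\<bar>)"
    by (auto simp: abs_mult)
  finally show ?thesis using f by (simp add: L2_def set_borel_measurable_def)
qed

lemma L2_poly: "L2 (poly p)"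
  by (intro L2_continuous poly_continuous_on)

lemma sq_norm_nonneg: "sq_norm f \<ge> 0"
  unfolding sq_norm_def set_lebesgue_integral_def by (intro integral_nonneg_AE AE_I2) simp

lemma sq_norm_le_of_pointwise:
  assumes "L2 f" "set_integrable lborel Ioo11 g" "\<And>x. x \<in> Ioo11 \<Longrightarrow> (f x)\<^sup>2 \<le> g x"
  shows "sq_norm f \<le> (LINT x:Ioo11|lborel. g x)"
  unfolding sq_norm_def using assms by (intro set_integral_mono) (auto simp: L2_def)

text \<open>Stands in for the triangle inequality without square roots; the loss of a factor 2 is
  harmless in limit arguments.\<close>

lemma sq_norm_add_le:
  assumes "L2 f" "L2 g" shows "sq_norm (\<lambda>x. f x + g x) \<le> 2 * sq_norm f + 2 * sq_norm g"
proof -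
  have i: "set_integrable lborel Ioo11 (\<lambda>x. 2 * (f x)\<^sup>2)" "set_integrable lborel Ioo11 (\<lambda>x. 2 * (g x)\<^sup>2)"
    using assms by (auto simp: L2_def)
  have "sq_norm (\<lambda>x. f x + g x) \<le> (LINT x:Ioo11|lborel. 2 * (f x)\<^sup>2 + 2 * (g x)\<^sup>2)"
  proof (rule sq_norm_le_of_pointwise[OF L2_add[OF assms] set_integral_add(1)[OF i]])
    show "(f x + g x)\<^sup>2 \<le> 2 * (f x)\<^sup>2 + 2 * (g x)\<^sup>2" for x
      using sum_squares_bound[of "f x" "g x"] by (simp add: power2_sum)
  qed
  also have "\<dots> = 2 * sq_norm f + 2 * sq_norm g" using i by (simp add: set_integral_add sq_norm_def)
  finally show ?thesis .
qed

text \<open>The factor 2 is the length of the interval.\<close>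

lemma sq_norm_bound:
  assumes "L2 f" "\<And>x. x \<in> Ioo11 \<Longrightarrow> \<bar>f x\<bar> \<le> B" shows "sq_norm f \<le> 2 * B\<^sup>2"
proof -
  have "sq_norm f \<le> (LINT x:Ioo11|lborel. B\<^sup>2)"
  proof (rule sq_norm_le_of_pointwise[OF assms(1)])
    show "(f x)\<^sup>2 \<le> B\<^sup>2" if "x \<in> Ioo11" for x
      using assms(2)[OF that] by (rule abs_le_square_iff[THEN iffD1, OF order_trans]) simp
  qed (rule LINT_Ioo11_continuous, simp)
  then show ?thesis by (simp add: LINT_Ioo11_continuous(2))
qed

text \<open>AM-GM in the form \<open>\<bar>v\<bar> \<le> v\<^sup>2 / (2 d) + d / 2\<close> replaces the Cauchy-Schwarz inequality.\<close>

lemma LINT_abs_le: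
  assumes "L2 v" "sq_norm v \<le> d\<^sup>2" "d > 0" shows "(LINT x:Ioo11|lborel. \<bar>v x\<bar>) \<le> 2 * d"
proof -
  have i: "set_integrable lborel Ioo11 (\<lambda>x. (v x)\<^sup>2 / (2 * d))" "set_integrable lborel Ioo11 (\<lambda>x. d / 2)"
    using assms(1) by (auto simp: L2_def intro: LINT_Ioo11_continuous)
  have "(LINT x:Ioo11|lborel. \<bar>v x\<bar>) \<le> (LINT x:Ioo11|lborel. (v x)\<^sup>2 / (2 * d) + d / 2)"
  proof (rule set_integral_mono[OF L2_integrable[OF L2_abs[OF assms(1)]] set_integral_add(1)[OF i]])
    fix x
    show "\<bar>v x\<bar> \<le> (v x)\<^sup>2 / (2 * d) + d / 2"
      using sum_squares_bound[of "\<bar>v x\<bar>" d] assms(3) by (simp add: field_simps power2_eq_square)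
  qed
  also have "\<dots> = sq_norm v / (2 * d) + d"
    by (subst set_integral_add(2)[OF i]) (simp add: sq_norm_def LINT_Ioo11_continuous(2))
  also have "\<dots> \<le> d\<^sup>2 / (2 * d) + d" using assms by (intro add_right_mono divide_right_mono) auto
  also have "\<dots> \<le> 2 * d" using assms(3) by (simp add: power2_eq_square)
  finally show ?thesis .
qed

lemma sq_norm_tendsto_zero:
  assumes "\<And>n. L2 (h n)" "L2 W"
    "AE x in lborel. x \<in> Ioo11 \<longrightarrow> (\<lambda>n. h n x) \<longlonglongrightarrow> 0"
    "\<And>n x. x \<in> Ioo11 \<Longrightarrow> \<bar>h n x\<bar> \<le> \<bar>W x\<bar>"
  shows "(\<lambda>n. sq_norm (h n)) \<longlonglongrightarrow> 0"
proof -
  have "(\<lambda>n. LINT x|lborel. indicator Ioo11 x *\<^sub>R (h n x)\<^sup>2) \<longlonglongrightarrow> (LINT x|(lborel :: real measure). (0::real))"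
  proof (rule integral_dominated_convergence[where w = "\<lambda>x. indicator Ioo11 x *\<^sub>R (W x)\<^sup>2"
        and f = "\<lambda>_. 0" and s = "\<lambda>n x. indicator Ioo11 x *\<^sub>R (h n x)\<^sup>2"])
    show "integrable lborel (\<lambda>x. indicator Ioo11 x *\<^sub>R (W x)\<^sup>2)"
      using assms(2) by (simp add: L2_def set_integrable_def)
    show "(\<lambda>x. indicator Ioo11 x *\<^sub>R (h n x)\<^sup>2) \<in> borel_measurable lborel" for n
      using assms(1)[of n] unfolding L2_def set_integrable_def by auto
    show "AE x in lborel. (\<lambda>n. indicator Ioo11 x *\<^sub>R (h n x)\<^sup>2) \<longlonglongrightarrow> 0"
      using assms(3)
    proof eventually_elim
      case (elim x)
      show ?case
      proof (cases "x \<in> Ioo11")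
        case True
        then have "(\<lambda>n. (h n x)\<^sup>2) \<longlonglongrightarrow> 0\<^sup>2" using elim by (intro tendsto_power) auto
        then show ?thesis using True by simp
      qed simp
    qed
    show "AE x in lborel. norm (indicator Ioo11 x *\<^sub>R (h n x)\<^sup>2) \<le> indicator Ioo11 x *\<^sub>R (W x)\<^sup>2" for n
      using assms(4) by (intro AE_I2) (auto simp: indicator_def abs_le_square_iff)
  qed simp
  then show ?thesis by (simp add: sq_norm_def set_lebesgue_integral_def)
qed

section \<open>Truncation and approximation by eigenfunction sums\<close>

definition clip :: "real \<Rightarrow> real \<Rightarrow> real" where
  "clip M y = max (- M) (min M y)"

lemma clip_bound: "M \<ge> 0 \<Longrightarrow> \<bar>clip M y\<bar> \<le> M"
  by (auto simp: clip_def)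

lemma clip_id: "\<bar>y\<bar> \<le> M \<Longrightarrow> clip M y = y"
  by (auto simp: clip_def)

lemma continuous_on_clip: "continuous_on A f \<Longrightarrow> continuous_on A (\<lambda>x. clip M (f x))"
  unfolding clip_def by (intro continuous_intros)

lemma L2_clip:
  assumes "L2 f" "M \<ge> 0" shows "L2 (\<lambda>x. clip M (f x))"
  unfolding L2_def
proof
  have "(\<lambda>x. clip M (indicator Ioo11 x * f x)) \<in> borel_measurable borel"
    unfolding clip_def using L2D_measurable[OF assms(1)] by measurable
  also have "(\<lambda>x. clip M (indicator Ioo11 x * f x)) = (\<lambda>x. indicator Ioo11 x * clip M (f x))"
    using assms(2) by (auto simp: clip_def indicator_def)
  finally show m: "set_borel_measurable lborel Ioo11 (\<lambda>x. clip M (f x))"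
    by (simp add: set_borel_measurable_def)
  have le: "\<bar>clip M y\<bar> \<le> \<bar>y\<bar>" for y using assms(2) by (auto simp: clip_def)
  have "(\<lambda>x. (indicator Ioo11 x * clip M (f x))\<^sup>2) \<in> borel_measurable borel"
    using m unfolding set_borel_measurable_def by (simp add: measurable_lborel1) measurable
  also have "(\<lambda>x. (indicator Ioo11 x * clip M (f x))\<^sup>2) = (\<lambda>x. indicator Ioo11 x *\<^sub>R (clip M (f x))\<^sup>2)"
    by (auto simp: indicator_def)
  finally have m2: "(\<lambda>x. indicator Ioo11 x *\<^sub>R (clip M (f x))\<^sup>2) \<in> borel_measurable lborel" by simp
  show "set_integrable lborel Ioo11 (\<lambda>x. (clip M (f x))\<^sup>2)"
    unfolding set_integrable_def
  proof (rule Bochner_Integration.integrable_bound)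
    show "integrable lborel (\<lambda>x. indicator Ioo11 x *\<^sub>R (f x)\<^sup>2)"
      using assms(1) by (simp add: L2_def set_integrable_def)
    show "AE x in lborel. norm (indicator Ioo11 x *\<^sub>R (clip M (f x))\<^sup>2) \<le> norm (indicator Ioo11 x *\<^sub>R (f x)\<^sup>2)"
      using le by (intro AE_I2) (auto simp: indicator_def abs_le_square_iff)
  qed (rule m2)
qed

lemma approx_by_bounded:
  assumes "L2 f" "e > 0"
  shows "\<exists>M>0. sq_norm (\<lambda>x. f x - clip M (f x)) < e"
proof -
  have "(\<lambda>n. sq_norm (\<lambda>x. f x - clip (real (Suc n)) (f x))) \<longlonglongrightarrow> 0"
  proof (rule sq_norm_tendsto_zero[OF _ assms(1)])
    show "L2 (\<lambda>x. f x - clip (real (Suc n)) (f x))" for n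
      by (intro L2_diff L2_clip assms) auto
    show "\<bar>f x - clip (real (Suc n)) (f x)\<bar> \<le> \<bar>f x\<bar>" for n x
      by (auto simp: clip_def)
    show "AE x in lborel. x \<in> Ioo11 \<longrightarrow> (\<lambda>n. f x - clip (real (Suc n)) (f x)) \<longlonglongrightarrow> 0"
    proof (intro AE_I2 impI tendsto_eventually)
      fix x
      obtain N :: nat where "\<bar>f x\<bar> < real N" using reals_Archimedean2 by blast
      then show "\<forall>\<^sub>F n in sequentially. f x - clip (real (Suc n)) (f x) = 0"
        by (intro eventually_sequentiallyI[of N]) (simp add: clip_id)
    qed
  qed
  from order_tendstoD(2)[OF this assms(2)] obtain n where "sq_norm (\<lambda>x. f x - clip (real (Suc n)) (f x)) < e"
    by (auto dest: eventually_happens)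
  then show ?thesis by (intro exI[of _ "real (Suc n)"]) simp
qed

text \<open>Dividing by \<open>max (1 - x\<^sup>2) (1 / n)\<close> keeps the approximants continuous while making them vanish
  at the endpoints like \<open>1 - x\<^sup>2\<close>.\<close>

lemma approx_bounded_by_continuous:
  assumes "L2 f" "M > 0" "\<And>x. \<bar>f x\<bar> \<le> M" "e > 0"
  shows "\<exists>q. continuous_on {-1..1} q \<and> sq_norm (\<lambda>x. f x - (1 - x\<^sup>2) * q x) < e"
proof -
  have "(\<lambda>x. indicator Ioo11 x * f x) \<in> borel_measurable lebesgue"
    using L2D_measurable[OF assms(1)] by (intro measurable_completion) simp
  then have "(\<lambda>x. indicator Ioo11 x * f x) measurable_on UNIV"
    by (rule lebesgue_measurable_imp_measurable_on) simp
  \<comment> \<open>Measurability supplies continuous functions converging to \<open>f\<close> off a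
    null set. Clipping them at \<open>M\<close> keeps this limit, since \<bar>f\<bar> \<le> M, and
    provides a common bound.\<close>
  then obtain N g where N: "negligible N" and g: "\<And>n. continuous_on UNIV (g n)"
    and lim: "\<And>x. x \<notin> N \<Longrightarrow> (\<lambda>n. g n x) \<longlonglongrightarrow> indicator Ioo11 x * f x"
    unfolding measurable_on_def by auto
  define q where "q n x = clip M (g n x) / max (1 - x\<^sup>2) (1 / real (Suc n))" for n :: nat and x :: real
  have pos: "max (1 - x\<^sup>2) (1 / real (Suc n)) > 0" for n and x :: real
    by (rule less_le_trans[OF _ max.cobounded2]) simp
  have cq: "continuous_on {-1..1} (q n)" for n
    unfolding q_def
    by (intro continuous_intros continuous_on_clip continuous_on_subset[OF g]) (use pos in \<open>auto simp: less_imp_neq[symmetric]\<close>)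
  have bd: "\<bar>(1 - x\<^sup>2) * q n x\<bar> \<le> M" if "x \<in> Ioo11" for n x
  proof -
    have x: "0 \<le> 1 - x\<^sup>2" using that abs_square_le_1[of x] by auto
    have "\<bar>(1 - x\<^sup>2) * q n x\<bar> = (1 - x\<^sup>2) / max (1 - x\<^sup>2) (1 / real (Suc n)) * \<bar>clip M (g n x)\<bar>"
      using x pos[of x n] by (simp add: q_def abs_mult)
    also have "\<dots> \<le> 1 * M"
      using clip_bound[of M "g n x"] assms(2) pos[of x n] x by (intro mult_mono) (auto simp: divide_le_eq)
    finally show ?thesis by simp
  qed
  have "(\<lambda>n. sq_norm (\<lambda>x. f x - (1 - x\<^sup>2) * q n x)) \<longlonglongrightarrow> 0"
  proof (rule sq_norm_tendsto_zero[where W = "\<lambda>_. 2 * M"])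
    show "L2 (\<lambda>x. f x - (1 - x\<^sup>2) * q n x)" for n
      by (intro L2_diff assms L2_continuous continuous_intros cq)
    show "L2 (\<lambda>_. 2 * M)" by (intro L2_continuous continuous_intros)
    show "\<bar>f x - (1 - x\<^sup>2) * q n x\<bar> \<le> \<bar>2 * M\<bar>" if "x \<in> Ioo11" for n x
      using assms(3)[of x] bd[OF that, of n] assms(2) by linarith
    have "AE x in lebesgue. x \<notin> N" using N by (auto simp: negligible_iff_null_sets intro: AE_not_in)
    then have "AE x in lborel. x \<notin> N" by (simp add: AE_completion_iff)
    then show "AE x in lborel. x \<in> Ioo11 \<longrightarrow> (\<lambda>n. f x - (1 - x\<^sup>2) * q n x) \<longlonglongrightarrow> 0"
    proof eventually_elim
      case (elim x)
      show ?case
      proof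
        assume x: "x \<in> Ioo11"
        have x2: "1 - x\<^sup>2 > 0" using x abs_square_less_1[of x] by auto
        have "(\<lambda>n. clip M (g n x)) \<longlonglongrightarrow> clip M (f x)"
          using lim[OF elim] x unfolding clip_def by (intro tendsto_intros) auto
        then have c: "(\<lambda>n. f x - clip M (g n x)) \<longlonglongrightarrow> f x - f x"
          using clip_id[OF assms(3)] by (intro tendsto_intros) simp
        have "\<forall>\<^sub>F n in sequentially. 1 / real (Suc n) < 1 - x\<^sup>2"
          by (rule order_tendstoD(2)[OF LIMSEQ_Suc[OF lim_1_over_n] x2])
        then have "\<forall>\<^sub>F n in sequentially. f x - clip M (g n x) = f x - (1 - x\<^sup>2) * q n x"
          by eventually_elim (use x2 in \<open>auto simp: q_def max_def\<close>)
        from tendsto_cong[OF this] c show "(\<lambda>n. f x - (1 - x\<^sup>2) * q n x) \<longlonglongrightarrow> 0" by simp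
      qed
    qed
  qed
  from order_tendstoD(2)[OF this assms(4)] obtain n where "sq_norm (\<lambda>x. f x - (1 - x\<^sup>2) * q n x) < e"
    by (auto dest: eventually_happens)
  then show ?thesis using cq by blast
qed

text \<open>Three approximations in turn: \<open>f\<close> by its truncation, that by (1 - x^2)
  times a continuous function, and the latter factor by a polynomial (Stone-Weierstrass). Expanding
  the polynomial in the \<open>psi n\<close> and multiplying by 1 - x^2 gives a sum of
  \<open>phi n\<close>.\<close>

lemma approx_by_phi:
  assumes "L2 f" "e > 0"
  shows "\<exists>N a. sq_norm (\<lambda>x. f x - (\<Sum>n<N. a n * poly (phi n) x)) < e"
proof -
  \<comment> \<open>With two uses of \<open>sq_norm_add_le\<close> the errors enter with weights 2,
    4 and 4. Bounds e/16, e/16 and e/8 give a total below 7e/8.\<close>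
  obtain M where M: "M > 0" "sq_norm (\<lambda>x. f x - clip M (f x)) < e / 16"
    using approx_by_bounded[OF assms(1), of "e/16"] assms(2) by auto
  have fM: "L2 (\<lambda>x. clip M (f x))" using L2_clip assms(1) M(1) by simp
  obtain q where q: "continuous_on {-1..1} q" "sq_norm (\<lambda>x. clip M (f x) - (1 - x\<^sup>2) * q x) < e / 16"
    using approx_bounded_by_continuous[OF fM M(1) clip_bound, of "e/16"] M(1) assms(2) by auto
  define d where "d = sqrt (e / 16)"
  have d: "d > 0" "d\<^sup>2 = e / 16" using assms(2) by (auto simp: d_def)
  obtain r where r: "real_polynomial_function r" "\<And>x. x \<in> {-1..1} \<Longrightarrow> \<bar>q x - r x\<bar> < d"
    using Stone_Weierstrass_real_polynomial_function[OF _ q(1) d(1)] compact_Icc by metis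
  obtain b m where rb: "r = (\<lambda>x. \<Sum>i\<le>m. b i * x^i)"
    using r(1) unfolding real_polynomial_function_iff_sum by blast
  define P where "P = (\<Sum>i\<le>m. monom (b i) i)"
  have rP: "r x = poly P x" for x by (simp add: rb P_def poly_sum poly_monom)
  obtain a where a: "P = (\<Sum>n<Suc (degree P). smult (a n) (psi n))"
    using poly_in_span_psi[of P "Suc (degree P)"] by auto
  have eq: "(1 - x\<^sup>2) * r x = (\<Sum>n<Suc (degree P). a n * poly (phi n) x)" for x
    unfolding rP by (subst a) (simp add: poly_sum poly_phi sum_distrib_left mult_ac del: sum.lessThan_Suc)
  have Lr: "L2 (\<lambda>x. (1 - x\<^sup>2) * r x)" "L2 (\<lambda>x. (1 - x\<^sup>2) * q x)"
    unfolding rP by (intro L2_continuous continuous_intros q)+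
  have 3: "sq_norm (\<lambda>x. (1 - x\<^sup>2) * q x - (1 - x\<^sup>2) * r x) \<le> 2 * (e / 16)"
    unfolding d(2)[symmetric]
  proof (rule sq_norm_bound[OF L2_diff[OF Lr(2,1)]])
    fix x assume x: "x \<in> Ioo11"
    have x2: "0 \<le> 1 - x\<^sup>2" "1 - x\<^sup>2 \<le> 1" using x abs_square_le_1[of x] by auto
    have "\<bar>(1 - x\<^sup>2) * (q x - r x)\<bar> \<le> 1 * d"
      unfolding abs_mult using r(2)[of x] x x2 by (intro mult_mono) auto
    then show "\<bar>(1 - x\<^sup>2) * q x - (1 - x\<^sup>2) * r x\<bar> \<le> d" by (simp add: right_diff_distrib)
  qed
  have "sq_norm (\<lambda>x. f x - (1 - x\<^sup>2) * r x) = sq_norm (\<lambda>x. (f x - clip M (f x)) + ((clip M (f x) - (1 - x\<^sup>2) * q x) + ((1 - x\<^sup>2) * q x - (1 - x\<^sup>2) * r x)))"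
    by simp
  also have "\<dots> \<le> 2 * sq_norm (\<lambda>x. f x - clip M (f x)) + 2 * sq_norm (\<lambda>x. (clip M (f x) - (1 - x\<^sup>2) * q x) + ((1 - x\<^sup>2) * q x - (1 - x\<^sup>2) * r x))"
    by (intro sq_norm_add_le L2_add L2_diff assms fM Lr)
  also have "\<dots> \<le> 2 * sq_norm (\<lambda>x. f x - clip M (f x)) + 2 * (2 * sq_norm (\<lambda>x. clip M (f x) - (1 - x\<^sup>2) * q x) + 2 * sq_norm (\<lambda>x. (1 - x\<^sup>2) * q x - (1 - x\<^sup>2) * r x))"
    by (intro add_left_mono mult_left_mono sq_norm_add_le L2_diff fM Lr) auto
  also have "\<dots> < e"
  proof -
    have "2 * A + 2 * (2 * B + 2 * C) < e" if "A < e / 16" "B < e / 16" "C \<le> 2 * (e / 16)" for A B C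
      using that assms(2) by argo
    from this[OF M(2) q(2) 3] show ?thesis .
  qed
  finally show ?thesis unfolding eq by blast
qed

section \<open>The evolution and its initial value\<close>

text \<open>The functional dual to \<open>phi n\<close> under the unweighted pairing. Integrating
  against the bounded \<open>psi n\<close>, in place of \<open>phi n\<close> with the singular
  weight, makes it meaningful on all of L^2.\<close>

definition mode_coeff :: "(real \<Rightarrow> real) \<Rightarrow> nat \<Rightarrow> real" where
  "mode_coeff v n = (LINT x:Ioo11|lborel. v x * poly (psi n) x) / psi_norm n"

definition evol :: "real \<Rightarrow> (real \<Rightarrow> real) \<Rightarrow> real \<Rightarrow> real \<Rightarrow> real" where
  "evol lam v = mode_series lam (\<lambda>n x. mode_coeff v n * poly (phi n) x)"

lemma mode_coeff_bound:
  assumes "L2 v"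
  shows "\<bar>mode_coeff v n\<bar> \<le> (4 * 32^n) * (1 / psi_norm n) * (LINT x:Ioo11|lborel. \<bar>v x\<bar>)"
proof -
  have "\<bar>LINT x:Ioo11|lborel. v x * poly (psi n) x\<bar> \<le> (LINT x:Ioo11|lborel. \<bar>v x * poly (psi n) x\<bar>)"
    using set_integral_norm_bound[OF L2_prod[OF assms L2_poly[of "psi n"]]] by simp
  also have "\<dots> \<le> (LINT x:Ioo11|lborel. (4 * 32^n) * \<bar>v x\<bar>)"
  proof (rule set_integral_mono)
    show "set_integrable lborel Ioo11 (\<lambda>x. \<bar>v x * poly (psi n) x\<bar>)"
      using set_integrable_abs[OF L2_prod[OF assms L2_poly[of "psi n"]]] .
    show "set_integrable lborel Ioo11 (\<lambda>x. (4 * 32^n) * \<bar>v x\<bar>)"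
      using L2_integrable[OF L2_abs[OF assms]] by simp
    show "\<bar>v x * poly (psi n) x\<bar> \<le> (4 * 32^n) * \<bar>v x\<bar>" if "x \<in> Ioo11" for x
      using psi_bound(1)[of x n] that mult_right_mono[of "\<bar>poly (psi n) x\<bar>" "4 * 32^n" "\<bar>v x\<bar>"]
      by (simp add: abs_mult mult.commute)
  qed
  also have "\<dots> = (4 * 32^n) * (LINT x:Ioo11|lborel. \<bar>v x\<bar>)" by simp
  finally have "\<bar>LINT x:Ioo11|lborel. v x * poly (psi n) x\<bar> / psi_norm n
      \<le> (4 * 32^n) * (LINT x:Ioo11|lborel. \<bar>v x\<bar>) / psi_norm n"
    using psi_norm_pos[of n] by (intro divide_right_mono) auto
  then show ?thesis using psi_norm_pos[of n] by (simp add: mode_coeff_def)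
qed

lemma exp_bounded_mono:
  assumes "exp_bounded g" "\<And>n x. x \<in> {-1..1} \<Longrightarrow> \<bar>f n x\<bar> \<le> g n x" shows "exp_bounded f"
proof -
  obtain A C where "0 \<le> A" "0 \<le> C" "\<And>n x. x \<in> {-1..1} \<Longrightarrow> \<bar>g n x\<bar> \<le> A * C^n"
    using assms(1) unfolding exp_bounded_def by blast
  moreover from this assms(2) have "\<bar>f n x\<bar> \<le> A * C^n" if "x \<in> {-1..1}" for n x
    using that by (meson abs_ge_self order_trans)
  ultimately show ?thesis unfolding exp_bounded_def by blast
qed

lemma exp_bounded_power: "C \<ge> 0 \<Longrightarrow> A \<ge> 0 \<Longrightarrow> exp_bounded (\<lambda>n x. A * C^n)"
  unfolding exp_bounded_def by (intro exI[of _ A] exI[of _ C]) auto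

lemma exp_bounded_mode_coeff: "L2 v \<Longrightarrow> exp_bounded (\<lambda>n x. mode_coeff v n)"
  by (rule exp_bounded_mono[OF exp_bounded_mult[OF exp_bounded_mult[OF exp_bounded_power[of 32 4]
        exp_bounded_inverse_psi_norm] exp_bounded_const] mode_coeff_bound]) auto

text \<open>A smoothing estimate from L^1 to the supremum norm. The constant may depend on t but not
  on \<open>v\<close>, which is enough for a density argument at fixed t.\<close>

lemma evol_bound:
  assumes "lam > 0" "t > 0"
  shows "\<exists>M\<ge>0. \<forall>v. L2 v \<longrightarrow> (\<forall>x\<in>{-1..1}. \<bar>evol lam v x t\<bar> \<le> M * (LINT x:Ioo11|lborel. \<bar>v x\<bar>))"
proof -
  \<comment> \<open>Product of the bounds for the coefficient, apart from the L^1 norm of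
    \<open>v\<close>, and for \<open>phi n\<close>; \<open>x\<close> is a dummy that fits the shape
    of a mode.\<close>
  define g where "g n x = (4 * 32^n) * (1 / psi_norm n) * (4 * 32^n)" for n and x :: real
  have g: "exp_bounded g" unfolding g_def
    by (intro exp_bounded_mult exp_bounded_inverse_psi_norm exp_bounded_power) auto
  have gs: "summable (\<lambda>n. exp (- decay_rate lam n * t) * g n 0)"
    by (rule mode_series_summable[OF assms g]) simp
  have "\<bar>evol lam v x t\<bar> \<le> mode_series lam g 0 t * (LINT x:Ioo11|lborel. \<bar>v x\<bar>)"
    if v: "L2 v" and x: "x \<in> {-1..1}" for v x
  proof -
    let ?I = "LINT x:Ioo11|lborel. \<bar>v x\<bar>"
    have "norm (\<Sum>n. exp (- decay_rate lam n * t) * (mode_coeff v n * poly (phi n) x))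
        \<le> (\<Sum>n. exp (- decay_rate lam n * t) * g n 0 * ?I)"
    proof (rule norm_suminf_le)
      fix n
      have "\<bar>mode_coeff v n\<bar> * \<bar>poly (phi n) x\<bar> \<le> ((4 * 32^n) * (1 / psi_norm n) * ?I) * (4 * 32^n)"
        by (rule mult_mono[OF mode_coeff_bound[OF v] phi_bound(1)[OF x]])
           (use order_trans[OF abs_ge_zero mode_coeff_bound[OF v]] in auto)
      then have "exp (- decay_rate lam n * t) * (\<bar>mode_coeff v n\<bar> * \<bar>poly (phi n) x\<bar>) \<le> exp (- decay_rate lam n * t) * (g n 0 * ?I)"
        by (intro mult_left_mono) (auto simp: g_def mult_ac)
      then show "norm (exp (- decay_rate lam n * t) * (mode_coeff v n * poly (phi n) x)) \<le> exp (- decay_rate lam n * t) * g n 0 * ?I"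
        by (simp add: abs_mult mult.assoc)
    qed (rule summable_mult2[OF gs])
    also have "\<dots> = mode_series lam g 0 t * ?I" unfolding mode_series_def by (rule suminf_mult2[OF gs, symmetric])
    finally show ?thesis by (simp add: evol_def mode_series_def)
  qed
  moreover have "mode_series lam g 0 t \<ge> 0"
    unfolding mode_series_def using psi_norm_pos by (intro suminf_nonneg gs) (auto simp: g_def less_imp_le)
  ultimately show ?thesis by blast
qed

text \<open>Finite sums are kept as polynomials, so that the energy computation takes place among
  polynomials.\<close>

definition mode_sum :: "real \<Rightarrow> nat \<Rightarrow> (nat \<Rightarrow> real) \<Rightarrow> real \<Rightarrow> real poly" where
  "mode_sum lam N a t = (\<Sum>n<N. smult (exp (- decay_rate lam n * t) * a n) (phi n))"

lemma poly_mode_sum: "poly (mode_sum lam N a t) x = (\<Sum>n<N. exp (- decay_rate lam n * t) * (a n * poly (phi n) x))"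
  by (simp add: mode_sum_def poly_sum mult.assoc)

lemma mode_coeff_mode_sum: "mode_coeff (poly (mode_sum lam N a 0)) m = (if m < N then a m else 0)"
proof -
  have "(LINT x:Ioo11|lborel. poly (mode_sum lam N a 0) x * poly (psi m) x)
      = integral {-1..1} (\<lambda>x. poly (mode_sum lam N a 0) x * poly (psi m) x)"
    by (intro LINT_Ioo11_continuous continuous_intros)
  also have "\<dots> = integral {-1..1} (\<lambda>x. \<Sum>n<N. a n * poly (phi n * psi m) x)"
    by (intro integral_cong) (simp add: poly_mode_sum sum_distrib_right mult.assoc)
  also have "\<dots> = (\<Sum>n<N. integral {-1..1} (\<lambda>x. a n * poly (phi n * psi m) x))"
    by (intro integral_sum integrable_continuous_real continuous_intros) auto
  also have "\<dots> = (\<Sum>n<N. if n = m then a m * psi_norm m else 0)"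
  proof (rule sum.cong[OF refl])
    fix n
    have "integral {-1..1} (\<lambda>x. a n * poly (phi n * psi m) x) = a n * integral {-1..1} (poly (phi n * psi m))"
      by (rule integral_mult_right)
    then show "integral {-1..1} (\<lambda>x. a n * poly (phi n * psi m) x) = (if n = m then a m * psi_norm m else 0)"
      using psi_orthogonal[of n m] unfolding psi_norm_def by auto
  qed
  also have "\<dots> = (if m < N then a m * psi_norm m else 0)" by simp
  finally show ?thesis using psi_norm_pos[of m] by (simp add: mode_coeff_def)
qed

lemma evol_mode_sum: "evol lam (poly (mode_sum lam N a 0)) x t = poly (mode_sum lam N a t) x"
proof -
  have "evol lam (poly (mode_sum lam N a 0)) x t
      = (\<Sum>n\<in>{..<N}. exp (- decay_rate lam n * t) * (mode_coeff (poly (mode_sum lam N a 0)) n * poly (phi n) x))"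
    unfolding evol_def mode_series_def by (rule suminf_finite) (auto simp: mode_coeff_mode_sum)
  then show ?thesis by (simp add: poly_mode_sum mode_coeff_mode_sum)
qed

text \<open>The energy identity
  \<open>\<integral>(1 - x\<^sup>2) U U'' = - \<integral>(1 - x\<^sup>2) U'\<^sup>2 - \<integral>U\<^sup>2\<close>.\<close>

lemma energy_nonpos:
  fixes U :: "real poly"
  assumes "poly U 1 = 0" "poly U (-1) = 0"
  shows "integral {-1..1} (poly ([:1, 0, -1:] * U * pderiv (pderiv U))) \<le> 0"
proof -
  \<comment> \<open>The second summand x U^2 cancels the term -2 x U U' that arises from
    differentiating the weight and leaves U^2. Both summands vanish at the endpoints.\<close>
  define F where "F = [:1, 0, -1:] * U * pderiv U + [:0, 1:] * U * U"
  have F: "(poly (pderiv F) has_integral 0) {-1..1}"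
    using poly_FTC[of "-1" 1 F] assms by (simp add: F_def)
  have "integral {-1..1} (poly ([:1, 0, -1:] * U * pderiv (pderiv U))) \<le> integral {-1..1} (poly (pderiv F))"
  proof (intro integral_le poly_integrable)
    fix x :: real assume x: "x \<in> {-1..1}"
    have "poly (pderiv F) x = poly ([:1, 0, -1:] * U * pderiv (pderiv U)) x
        + (1 - x\<^sup>2) * (poly (pderiv U) x)\<^sup>2 + (poly U x)\<^sup>2"
      unfolding F_def pderiv_add pderiv_mult by (simp add: pderiv_pCons power2_eq_square algebra_simps)
    moreover have "(1 - x\<^sup>2) * (poly (pderiv U) x)\<^sup>2 \<ge> 0"
      using x abs_square_le_1[of x] by auto
    ultimately show "poly ([:1, 0, -1:] * U * pderiv (pderiv U)) x \<le> poly (pderiv F) x"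
      by (smt (verit) zero_le_power2)
  qed
  also have "\<dots> = 0" using F by (rule integral_unique)
  finally show ?thesis .
qed

lemma mode_sum_boundary: "poly (mode_sum lam N a t) 1 = 0" "poly (mode_sum lam N a t) (-1) = 0"
  by (simp_all add: poly_mode_sum)

lemma sq_norm_poly: "sq_norm (poly p) = integral {-1..1} (\<lambda>x. (poly p x)\<^sup>2)"
  unfolding sq_norm_def by (intro LINT_Ioo11_continuous continuous_intros)

lemma mode_sum_DERIV_t:
  "((\<lambda>t. poly (mode_sum lam N a t) x) has_real_derivative
     lam / 2 * poly ([:1, 0, -1:] * pderiv (pderiv (mode_sum lam N a t))) x) (at t)"
proof -
  have "((\<lambda>t. poly (mode_sum lam N a t) x) has_real_derivative
     (\<Sum>n<N. exp (- decay_rate lam n * t) * - decay_rate lam n * (a n * poly (phi n) x))) (at t)"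
    unfolding poly_mode_sum by (auto intro!: derivative_eq_intros sum.cong)
  also have "(\<Sum>n<N. exp (- decay_rate lam n * t) * - decay_rate lam n * (a n * poly (phi n) x))
     = lam / 2 * poly ([:1, 0, -1:] * pderiv (pderiv (mode_sum lam N a t))) x"
  proof -
    have "pderiv (pderiv (mode_sum lam N a t)) = (\<Sum>n<N. smult (exp (- decay_rate lam n * t) * a n) (smult (- eigval n) (psi n)))"
      using higher_pderiv_sum[of 2 "\<lambda>n. smult (exp (- decay_rate lam n * t) * a n) (phi n)" "{..<N}"]
      by (simp add: mode_sum_def numeral_2_eq_2 pderiv_smult pderiv2_phi)
    then have "lam / 2 * poly ([:1, 0, -1:] * pderiv (pderiv (mode_sum lam N a t))) x
       = lam / 2 * ((1 - x\<^sup>2) * (\<Sum>n<N. exp (- decay_rate lam n * t) * a n * (- eigval n * poly (psi n) x)))"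
      by (simp add: poly_sum power2_eq_square left_diff_distrib mult.assoc)
    also have "\<dots> = (\<Sum>n<N. exp (- decay_rate lam n * t) * - decay_rate lam n * (a n * poly (phi n) x))"
      unfolding sum_distrib_left by (intro sum.cong refl) (simp add: decay_rate_def poly_phi)
    finally show ?thesis by simp
  qed
  finally show ?thesis .
qed

text \<open>The time derivative of the squared norm is \<open>lam\<close> times the integral in
  \<open>energy_nonpos\<close>, hence not positive.\<close>

lemma mode_sum_contraction:
  assumes "lam > 0" "t \<ge> 0"
  shows "sq_norm (poly (mode_sum lam N a t)) \<le> sq_norm (poly (mode_sum lam N a 0))"
proof -
  define E where "E s = integral (cbox (-1) 1) (\<lambda>x. (poly (mode_sum lam N a s) x)\<^sup>2)" for s
  \<comment> \<open>Written with the explicit sum, because joint continuity in \<open>s\<close> and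
    \<open>x\<close> is then visible; \<open>Dt\<close> translates it into the spatial form.\<close>
  define D where "D s x = 2 * poly (mode_sum lam N a s) x * (\<Sum>n<N. exp (- decay_rate lam n * s) * - decay_rate lam n * (a n * poly (phi n) x))" for s x
  have Dt: "(\<Sum>n<N. exp (- decay_rate lam n * s) * - decay_rate lam n * (a n * poly (phi n) x))
      = lam / 2 * poly ([:1, 0, -1:] * pderiv (pderiv (mode_sum lam N a s))) x" for s x
  proof (rule DERIV_unique[OF _ mode_sum_DERIV_t])
    show "((\<lambda>t. poly (mode_sum lam N a t) x) has_real_derivative
       (\<Sum>n<N. exp (- decay_rate lam n * s) * - decay_rate lam n * (a n * poly (phi n) x))) (at s)"
      unfolding poly_mode_sum by (auto intro!: derivative_eq_intros sum.cong)
  qed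
  have dE: "(E has_real_derivative integral (cbox (-1) 1) (D s)) (at s)" for s
    unfolding E_def
  proof (rule leibniz_rule_field_derivative[where U = UNIV])
    show "((\<lambda>s. (poly (mode_sum lam N a s) x)\<^sup>2) has_real_derivative D s x) (at s within UNIV)" for s x
      unfolding D_def Dt by (auto intro!: derivative_eq_intros mode_sum_DERIV_t)
    show "(\<lambda>x. (poly (mode_sum lam N a s) x)\<^sup>2) integrable_on cbox (-1) 1" for s
      by (intro integrable_continuous continuous_intros)
    have "continuous_on UNIV (\<lambda>(s, x). D s x)"
      unfolding D_def poly_mode_sum split_beta
      by (intro continuous_intros continuous_on_compose2[OF poly_continuous_on[of UNIV]]) auto
    then show "continuous_on (UNIV \<times> cbox (-1) 1) (\<lambda>(s, x). D s x)"
      by (rule continuous_on_subset) auto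
  qed auto
  have neg: "integral (cbox (-1) 1) (D s) \<le> 0" for s
  proof -
    have "D s = (\<lambda>x. lam * poly ([:1, 0, -1:] * mode_sum lam N a s * pderiv (pderiv (mode_sum lam N a s))) x)"
      unfolding D_def Dt by (auto simp: fun_eq_iff algebra_simps)
    then have "integral (cbox (-1) 1) (D s)
        = lam * integral {-1..1} (poly ([:1, 0, -1:] * mode_sum lam N a s * pderiv (pderiv (mode_sum lam N a s))))"
      by (simp only: cbox_interval integral_mult_right)
    also have "\<dots> \<le> 0"
      using energy_nonpos[OF mode_sum_boundary] assms(1) by (intro mult_nonneg_nonpos) auto
    finally show ?thesis .
  qed
  have "E t \<le> E 0"
    using DERIV_nonpos_imp_nonincreasing[OF assms(2), of E] dE neg by blast
  then show ?thesis by (simp add: sq_norm_poly E_def)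
qed

lemma mode_sum_tendsto:
  "((\<lambda>t. sq_norm (\<lambda>x. poly (mode_sum lam N a t) x - poly (mode_sum lam N a 0) x)) \<longlongrightarrow> 0) (at_right 0)"
proof -
  have "continuous_on (UNIV \<times> cbox (-1) 1) (\<lambda>(t, x). (poly (mode_sum lam N a t) x - poly (mode_sum lam N a 0) x)\<^sup>2)"
    unfolding poly_mode_sum split_beta
    by (intro continuous_intros continuous_on_compose2[OF poly_continuous_on[of UNIV]]) auto
  then have "continuous_on UNIV (\<lambda>t. integral (cbox (-1) 1) (\<lambda>x. (poly (mode_sum lam N a t) x - poly (mode_sum lam N a 0) x)\<^sup>2))"
    by (rule integral_continuous_on_param)
  then have "isCont (\<lambda>t. integral (cbox (-1) 1) (\<lambda>x. (poly (mode_sum lam N a t) x - poly (mode_sum lam N a 0) x)\<^sup>2)) 0"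
    by (simp add: continuous_on_eq_continuous_at)
  then have "((\<lambda>t. integral (cbox (-1) 1) (\<lambda>x. (poly (mode_sum lam N a t) x - poly (mode_sum lam N a 0) x)\<^sup>2)) \<longlongrightarrow> 0) (at 0)"
    unfolding isCont_def by simp
  moreover have "sq_norm (\<lambda>x. poly (mode_sum lam N a t) x - poly (mode_sum lam N a 0) x)
     = integral (cbox (-1) 1) (\<lambda>x. (poly (mode_sum lam N a t) x - poly (mode_sum lam N a 0) x)\<^sup>2)" for t
    unfolding sq_norm_def cbox_interval by (intro LINT_Ioo11_continuous continuous_intros)
  ultimately show ?thesis
    by (simp add: filterlim_at_split)
qed

lemma evol_exp_bounded: "L2 v \<Longrightarrow> exp_bounded (\<lambda>n x. mode_coeff v n * poly (phi n) x)"
  by (rule exp_bounded_mult[OF exp_bounded_mode_coeff exp_bounded_phi])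

lemma mode_coeff_diff: "L2 u \<Longrightarrow> L2 v \<Longrightarrow> mode_coeff (\<lambda>x. u x - v x) n = mode_coeff u n - mode_coeff v n"
  unfolding mode_coeff_def using L2_prod[OF _ L2_poly[of "psi n"], of u] L2_prod[OF _ L2_poly[of "psi n"], of v]
  by (simp add: left_diff_distrib set_integral_diff diff_divide_distrib)

lemma evol_diff:
  assumes "lam > 0" "t > 0" "x \<in> {-1..1}" "L2 u" "L2 v"
  shows "evol lam (\<lambda>x. u x - v x) x t = evol lam u x t - evol lam v x t"
  unfolding evol_def mode_series_def
  by (subst suminf_diff[OF mode_series_summable[OF assms(1,2) evol_exp_bounded[OF assms(4)] assms(3)]
        mode_series_summable[OF assms(1,2) evol_exp_bounded[OF assms(5)] assms(3)]])
     (simp add: mode_coeff_diff[OF assms(4,5)] algebra_simps)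

lemma evol_cont2: "lam > 0 \<Longrightarrow> L2 v \<Longrightarrow> cont2 (evol lam v)"
  unfolding evol_def by (intro mode_series_cont2 evol_exp_bounded continuous_intros)

lemma evol_L2: "lam > 0 \<Longrightarrow> L2 v \<Longrightarrow> t > 0 \<Longrightarrow> L2 (\<lambda>x. evol lam v x t)"
  by (rule L2_continuous, rule cont2_slice_x[OF evol_cont2])

lemma L2_approx_mode_sum:
  assumes "L2 f" "e > 0"
  shows "\<exists>N a. sq_norm (\<lambda>x. f x - poly (mode_sum lam N a 0) x) < e"
  using approx_by_phi[OF assms] by (simp add: poly_mode_sum)

lemma sq_norm_cong: "(\<And>x. x \<in> Ioo11 \<Longrightarrow> f x = g x) \<Longrightarrow> sq_norm f = sq_norm g"
  unfolding sq_norm_def set_lebesgue_integral_def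
  by (intro Bochner_Integration.integral_cong) (auto simp: indicator_def)

lemma sq_norm_diff_commute: "sq_norm (\<lambda>x. f x - g x) = sq_norm (\<lambda>x. g x - f x)"
  by (simp add: sq_norm_def power2_commute)

text \<open>The point is a constant independent of t. A finite sum close to \<open>v\<close> is
  handled by contraction and the remainder by \<open>evol_bound\<close>; the t-dependent constant
  multiplies only d^2 and disappears as d tends to 0. The 4 stems from two uses of
  \<open>sq_norm_add_le\<close>.\<close>

lemma evol_sq_norm_le:
  assumes "lam > 0" "t > 0" "L2 v"
  shows "sq_norm (\<lambda>x. evol lam v x t) \<le> 4 * sq_norm v"
proof -
  obtain M where M: "M \<ge> 0" "\<And>v x. L2 v \<Longrightarrow> x \<in> {-1..1} \<Longrightarrow> \<bar>evol lam v x t\<bar> \<le> M * (LINT x:Ioo11|lborel. \<bar>v x\<bar>)"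
    using evol_bound[OF assms(1,2)] by blast
  have "sq_norm (\<lambda>x. evol lam v x t) \<le> 4 * sq_norm v + (16 * M\<^sup>2 + 4) * d\<^sup>2" if d: "d > 0" for d
  proof -
    obtain N a where w: "sq_norm (\<lambda>x. v x - poly (mode_sum lam N a 0) x) < d\<^sup>2"
      using L2_approx_mode_sum[OF assms(3), of "d\<^sup>2" lam] d by auto
    let ?w = "poly (mode_sum lam N a 0)" and ?wt = "poly (mode_sum lam N a t)"
    let ?v = "\<lambda>x. v x - ?w x"
    have Lv: "L2 ?v" by (intro L2_diff assms L2_poly)
    have "sq_norm (\<lambda>x. evol lam v x t) = sq_norm (\<lambda>x. evol lam ?v x t + ?wt x)"
      by (intro sq_norm_cong) (simp add: evol_diff[OF assms(1,2) _ assms(3) L2_poly] evol_mode_sum)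
    also have "\<dots> \<le> 2 * sq_norm (\<lambda>x. evol lam ?v x t) + 2 * sq_norm ?wt"
      by (intro sq_norm_add_le evol_L2 assms Lv L2_poly)
    also have "sq_norm (\<lambda>x. evol lam ?v x t) \<le> 2 * (M * (2 * d))\<^sup>2"
    proof (rule sq_norm_bound[OF evol_L2[OF assms(1) Lv assms(2)]])
      fix x assume "x \<in> Ioo11"
      then have "\<bar>evol lam ?v x t\<bar> \<le> M * (LINT x:Ioo11|lborel. \<bar>?v x\<bar>)" by (intro M Lv) auto
      also have "\<dots> \<le> M * (2 * d)" using w d by (intro mult_left_mono LINT_abs_le Lv M) auto
      finally show "\<bar>evol lam ?v x t\<bar> \<le> M * (2 * d)" .
    qed
    also have "sq_norm ?wt \<le> sq_norm ?w" using assms by (intro mode_sum_contraction) auto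
    also have "sq_norm ?w = sq_norm (\<lambda>x. v x + (?w x - v x))" by simp
    also have "\<dots> \<le> 2 * sq_norm v + 2 * sq_norm (\<lambda>x. ?w x - v x)"
      by (intro sq_norm_add_le L2_diff assms L2_poly)
    also have "sq_norm (\<lambda>x. ?w x - v x) \<le> d\<^sup>2" using w by (simp add: sq_norm_diff_commute)
    finally show ?thesis by (simp add: power_mult_distrib algebra_simps)
  qed
  then have le: "sq_norm (\<lambda>x. evol lam v x t) \<le> 4 * sq_norm v + (16 * M\<^sup>2 + 4) * d\<^sup>2" if "d > 0" for d
    using that by blast
  have "((\<lambda>d. 4 * sq_norm v + (16 * M\<^sup>2 + 4) * d\<^sup>2) \<longlongrightarrow> 4 * sq_norm v + (16 * M\<^sup>2 + 4) * 0\<^sup>2) (at_right 0)"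
    by (intro tendsto_intros)
  from tendsto_lowerbound[OF this, of "sq_norm (\<lambda>x. evol lam v x t)"] show ?thesis
    using le by (simp add: eventually_at_right_less eventually_mono[OF eventually_at_right_less])
qed

text \<open>With w a finite sum near v and S(t) the evolution, the error splits into S(t)(v - w),
  S(t)w - w and w - v. The first is small uniformly in t by \<open>evol_sq_norm_le\<close>, the
  second tends to 0 for fixed w.\<close>

lemma evol_tendsto_initial:
  assumes "lam > 0" "L2 v"
  shows "((\<lambda>t. sq_norm (\<lambda>x. evol lam v x t - v x)) \<longlongrightarrow> 0) (at_right 0)"
proof (rule order_tendstoI)
  fix e :: real assume "e < 0"
  then show "\<forall>\<^sub>F t in at_right 0. e < sq_norm (\<lambda>x. evol lam v x t - v x)"
    using sq_norm_nonneg less_le_trans by (intro always_eventually) blast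
next
  fix e :: real assume e: "0 < e"
  obtain N a where w: "sq_norm (\<lambda>x. v x - poly (mode_sum lam N a 0) x) < e / 32"
    using L2_approx_mode_sum[OF assms(2), of "e/32" lam] e by auto
  let ?w = "poly (mode_sum lam N a 0)" and ?wt = "\<lambda>t. poly (mode_sum lam N a t)"
  let ?v = "\<lambda>x. v x - ?w x"
  have Lv: "L2 ?v" by (intro L2_diff assms L2_poly)
  have "\<forall>\<^sub>F t in at_right 0. sq_norm (\<lambda>x. ?wt t x - ?w x) < e / 32"
    using order_tendstoD(2)[OF mode_sum_tendsto, of "e/32"] e by simp
  then show "\<forall>\<^sub>F t in at_right 0. sq_norm (\<lambda>x. evol lam v x t - v x) < e"
    using eventually_at_right_less
  proof eventually_elim
    case (elim t)
    have "sq_norm (\<lambda>x. evol lam v x t - v x) = sq_norm (\<lambda>x. evol lam ?v x t + ((?wt t x - ?w x) + (?w x - v x)))"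
      by (intro sq_norm_cong) (simp add: evol_diff[OF assms(1) elim(2) _ assms(2) L2_poly] evol_mode_sum)
    also have "\<dots> \<le> 2 * sq_norm (\<lambda>x. evol lam ?v x t) + 2 * sq_norm (\<lambda>x. (?wt t x - ?w x) + (?w x - v x))"
      by (intro sq_norm_add_le evol_L2 L2_add L2_diff L2_poly assms Lv elim)
    also have "sq_norm (\<lambda>x. evol lam ?v x t) \<le> 4 * sq_norm ?v" by (rule evol_sq_norm_le[OF assms(1) elim(2) Lv])
    also have "sq_norm (\<lambda>x. (?wt t x - ?w x) + (?w x - v x)) \<le> 2 * sq_norm (\<lambda>x. ?wt t x - ?w x) + 2 * sq_norm (\<lambda>x. ?w x - v x)"
      by (intro sq_norm_add_le L2_diff L2_poly assms)
    also have "sq_norm (\<lambda>x. ?w x - v x) = sq_norm ?v" by (rule sq_norm_diff_commute)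
    finally have le: "sq_norm (\<lambda>x. evol lam v x t - v x) \<le> 2 * (4 * sq_norm ?v) + 2 * (2 * sq_norm (\<lambda>x. ?wt t x - ?w x) + 2 * sq_norm ?v)"
      by simp
    \<comment> \<open>The weights add up to 12 A + 4 B, below e/2 for the choice e/32.\<close>
    have "2 * (4 * A) + 2 * (2 * B + 2 * A) < e" if "A < e / 32" "B < e / 32" for A B
      using that e by argo
    from le_less_trans[OF le this[OF w elim(1)]] show ?case .
  qed
qed

theorem theorem3p4:
  fixes lam p :: real and G0 :: "real \<Rightarrow> real"
  assumes "lam > 0" and "L2 G0"
  shows "\<exists>G Gx. weak_solution lam G0 p G Gx \<and>
           (H1 G0 \<longrightarrow>
              (\<exists>Gxx. L2loc_H1rho Gx Gxx) \<and> C_H1 G \<and> dt_L2loc_L2 G)"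
proof -
  \<comment> \<open>The affine function with the values 1 at 1 and \<open>p\<close> at -1. It is
    stationary for the equation, so the remainder \<open>u\<close> is evolved with zero boundary
    values.\<close>
  define l where "l x = ((1 + x) + p * (1 - x)) / 2" for x :: real
  define u where "u x = G0 x - l x" for x
  have cl: "continuous_on A l" for A unfolding l_def by (intro continuous_intros) auto
  have dl: "(l has_real_derivative (1 - p) / 2) (at x)" for x
    unfolding l_def by (auto intro!: derivative_eq_intros)
  have u: "L2 u" unfolding u_def by (intro L2_diff L2_continuous assms cl)
  \<comment> \<open>The modes and their first two spatial derivatives; \<open>f2\<close> is already
    rewritten through \<open>pderiv2_phi\<close>.\<close>
  define f f1 f2 where "f n x = mode_coeff u n * poly (phi n) x"
    and "f1 n x = mode_coeff u n * poly (pderiv (phi n)) x"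
    and "f2 n x = mode_coeff u n * (- eigval n * poly (psi n) x)" for n x
  have f: "exp_bounded f" "exp_bounded f1"
    unfolding f_def f1_def using u
    by (auto intro: exp_bounded_mult exp_bounded_mode_coeff exp_bounded_phi exp_bounded_pderiv_phi)
  have f2: "exp_bounded f2"
    using exp_bounded_mult[OF exp_bounded_mult[OF exp_bounded_mode_coeff[OF u] exp_bounded_eigval]
        exp_bounded_mult[OF exp_bounded_const[of "-1"] exp_bounded_psi]]
    by (simp add: f2_def[abs_def] mult.assoc)
  have ft: "exp_bounded (\<lambda>n x. - decay_rate lam n * f n x)"
    using exp_bounded_mult[OF exp_bounded_mult[OF exp_bounded_const exp_bounded_eigval] f(1), of "- lam / 2"]
    by (simp add: decay_rate_def)
  have df: "(f n has_real_derivative f1 n x) (at x)" for n x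
    unfolding f_def f1_def by (intro DERIV_cmult poly_DERIV)
  have df1: "(f1 n has_real_derivative f2 n x) (at x)" for n x
    unfolding f1_def f2_def using DERIV_cmult[OF poly_DERIV[of "pderiv (phi n)" x], of "mode_coeff u n"]
    by (simp add: pderiv2_phi)
  define G Gx where "G x t = l x + mode_series lam f x t" and "Gx x t = (1 - p) / 2 + mode_series lam f1 x t" for x t
  have c: "cont2 (mode_series lam f)" "cont2 (mode_series lam f1)" "cont2 (mode_series lam f2)" "cont2 (mode_series lam (\<lambda>n x. - decay_rate lam n * f n x))"
    using assms(1) f f2 ft by (auto intro!: mode_series_cont2 continuous_intros simp: f_def f1_def f2_def)
  have "weak_solution lam G0 p G Gx \<and> L2loc_H1rho Gx (mode_series lam f2) \<and> C_H1 G \<and> dt_L2loc_L2 G"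
  proof (rule classical_solution_weak)
    show "cont2 G" "cont2 Gx"
      using c(1,2) unfolding G_def Gx_def split_beta
      by (intro continuous_intros continuous_on_compose2[OF cl[of UNIV]]; simp)+
    show "cont2 (mode_series lam f2)" "cont2 (mode_series lam (\<lambda>n x. - decay_rate lam n * f n x))" by fact+
    show "((\<lambda>x. G x t) has_real_derivative Gx x t) (at x)" if "x \<in> Ioo11" "t > 0" for x t
      unfolding G_def Gx_def by (intro DERIV_add dl mode_series_DERIV_x assms f that df)
    show "((\<lambda>x. Gx x t) has_real_derivative mode_series lam f2 x t) (at x)" if "x \<in> Ioo11" "t > 0" for x t
      using DERIV_add[OF DERIV_const mode_series_DERIV_x[OF assms(1) f(2) f2 that df1]] unfolding Gx_def by simp
    show "((\<lambda>t. G x t) has_real_derivative mode_series lam (\<lambda>n x. - decay_rate lam n * f n x) x t) (at t)"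
      if "x \<in> {-1..1}" "t > 0" for x t
      using DERIV_add[OF DERIV_const mode_series_DERIV_t[OF assms(1) f(1) that]] unfolding G_def by simp
    show "mode_series lam (\<lambda>n x. - decay_rate lam n * f n x) x t = lam / 2 * (1 - x\<^sup>2) * mode_series lam f2 x t"
      if "x \<in> {-1..1}" "t > 0" for x t
      \<comment> \<open>The equation holds mode by mode: \<open>decay_rate lam n\<close> times
        \<open>phi n\<close> is lam/2 times (1 - x^2) times \<open>eigval n\<close> times
        \<open>psi n\<close>.\<close>
      unfolding mode_series_def
      by (subst suminf_mult[OF mode_series_summable[OF assms(1) that(2) f2 that(1)], symmetric])
         (simp add: f_def f2_def decay_rate_def poly_phi mult_ac)
    show "G 1 t = 1" "G (-1) t = p" for t
      by (simp_all add: G_def l_def mode_series_def f_def)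
    have "((\<lambda>t. sqrt (sq_norm (\<lambda>x. evol lam u x t - u x))) \<longlongrightarrow> sqrt 0) (at_right 0)"
      by (intro tendsto_real_sqrt evol_tendsto_initial assms u)
    \<comment> \<open>The affine part cancels, so the distance to \<open>G0\<close> is that of the
      evolution to \<open>u\<close>.\<close>
    moreover have "L2_dist (\<lambda>x. G x t) G0 = sqrt (sq_norm (\<lambda>x. evol lam u x t - u x))" for t
      by (simp add: L2_dist_def sq_norm_def G_def evol_def f_def[abs_def] u_def algebra_simps)
    ultimately show "((\<lambda>t. L2_dist (\<lambda>x. G x t) G0) \<longlongrightarrow> 0) (at_right 0)" by simp
  qed
  then show ?thesis by blast
qed

end
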